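(* Let $\mathbf{X}^*\succeq0$ be an optimal solution of $\min\{f(\mathbf{X}):\mathbf{X}\succeq0,\ \mathcal{A}(\mathbf{X})=\mathbf{b},\ g(\mathbf{X})\le0\}$ and let $(\mathbf{y}^*,\boldsymbol\lambda^* )\in\mathbb{R}^m\times\mathbb{R}^d_+$ be a corresponding dual solution. Write $\nabla_{\mathbf{X}}\mathcal{L}^*:=\nabla_{\mathbf{X}}\mathcal{L}(\mathbf{X}^*,\mathbf{y}^*,\boldsymbol\lambda^* )=\nabla f(\mathbf{X}^* )-\mathcal{A}^\top(\mathbf{y}^* )+\sum_{i=1}^d\boldsymbol\lambda_i^*\nabla g_i(\mathbf{X}^* )$ and $\tilde r:=n-\mathrm{rank}(\nabla_{\mathbf{X}}\mathcal{L}^* )$. Fix $r\ge\tilde r$ and denote $\delta(r):=\max\{\lambda_{n-r}(\nabla_{\mathbf{X}}\mathcal{L}^* ),\sqrt{\tilde r}\,\lambda_{n-r+\tilde r-1}(\nabla_{\mathbf{X}}\mathcal{L}^* )\}$, $\mathcal{D}_X=\{\mathbf{X}\succeq0:\|\mathbf{X}-\mathbf{X}^*\|_F\le2\delta(r)\}$, $\mathcal{D}_\lambda=\{\boldsymbol\lambda\in\mathbb{R}^d_+:\|\boldsymbol\lambda-\boldsymbol\lambda^*\|_2\le2\delta(r)\}$. Put $\Lambda:=\max_{\boldsymbol\lambda\in\mathcal{D}_\lambda}\|\boldsymbol\lambda\|_1$ and $\Gamma:=\max_{\mathbf{X}\in\mathcal{D}_X}\max_{i\in[d]}\|\nabla g_i(\mathbf{X})\|_F$.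 Let $\{(\mathbf{X}_t,\mathbf{y}_t,\boldsymbol\lambda_t)\}_{t\ge1}$ and $\{(\mathbf{Z}_t,\mathbf{w}_t,\boldsymbol\mu_t)\}_{t\ge2}$ be the sequences generated by the extragradient method (defined in the context) with a fixed step-size $$\eta\le\min\left\{\frac{1}{2\sqrt{(\beta+\Lambda\beta_g)^2+\|\mathcal{A}\|^2+\beta_g^2}},\ \frac{1}{2\max\{\|\mathcal{A}\|,\sqrt d\,\Gamma\}},\ \frac{1}{\beta+\Lambda\beta_g+\sqrt2\max\{\|\mathcal{A}\|,\Gamma\}}\right\}.$$ Assume the initialization satisfies $\|(\mathbf{X}_1,\mathbf{y}_1,\boldsymbol\lambda_1)-(\mathbf{X}^*,\mathbf{y}^*,\boldsymbol\lambda^* )\|\le R_0(r)$, where $$R_0(r)=\delta(r)\min\left\{1,\ \frac{(1/2)\eta}{1+2\eta\max\{\beta+\Lambda\beta_g,\ \|\mathcal{A}\|,\ \sqrt d\,\Gamma\}}\right\}.$$ Then for all $t\ge1$ the projections $\Pi_{\mathbb{S}^n_+}[\cdot]$ in the extragradient method can be replaced with the rank-$r$ truncated projections $\widehat\Pi^r_{\mathbb{S}^n_+}[\cdot]$ without changing the sequences $\{(\mathbf{X}_t,\mathbf{y}_t,\boldsymbol\lambda_t)\}_{t\ge1}$ and $\{(\mathbf{Z}_t,\mathbf{w}_t,\boldsymbol\mu_t)\}_{t\ge2}$. Moreover, for all $T\ge1$, with $\bar{\mathbf{X}}=\frac1T\sum_{t=1}^T\mathbf{Z}_{t+1}$, $$f(\bar{\mathbf{X}})-f(\mathbf{X}^*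 )\le\frac{R^2}{2\eta T},\qquad\|\mathcal{A}(\bar{\mathbf{X}})-\mathbf{b}\|_2\le\frac{R^2}{2\|\mathbf{y}^*\|_2\,\eta T},\qquad\sum_{i\in[d]:\,g_i(\bar{\mathbf{X}})>0}g_i(\bar{\mathbf{X}})\le\frac{R^2}{2\eta T},$$ where $R^2:=\|\mathbf{X}_1-\mathbf{X}^*\|_F^2+\max_{\mathbf{y}\in\mathcal{C}_y}\|\mathbf{y}_1-\mathbf{y}\|_2^2+\max_{\boldsymbol\lambda\in\mathcal{C}_\lambda}\|\boldsymbol\lambda_1-\boldsymbol\lambda\|_2^2$ with $\mathcal{C}_y:=\{\mathbf{y}\in\mathbb{R}^m:\|\mathbf{y}\|_2\le2\|\mathbf{y}^*\|_2\}$ and $\mathcal{C}_\lambda:=\{\boldsymbol\lambda\in\mathbb{R}^d_+:\|\boldsymbol\lambda\|_2\le\|\boldsymbol\lambda^*\|_2+\sqrt d\}$. Furthermore, for all $T\ge1$, $$f(\mathbf{Z}_{T+1})-f(\mathbf{X}^* )\le\frac{R_1}{\eta\sqrt T},\qquad\|\mathcal{A}(\mathbf{Z}_{T+1})-\mathbf{b}\|_2\le\frac{R_1}{\|\mathbf{y}^*\|_2\,\eta\sqrt T},\qquad\sum_{i\in[d]:\,g_i(\mathbf{Z}_{T+1})>0}g_i(\mathbf{Z}_{T+1})\le\frac{R_1}{\eta\sqrt T},$$ where $R_1:=3\sqrt2\max\{2R_0(r),\,3\sqrt2\|\mathbf{y}^*\|_2,\,\sqrt2(2\|\boldsymbol\lambda^*\|_2+\sqrt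 d)\}\,\|(\mathbf{X}_1,\mathbf{y}_1,\boldsymbol\lambda_1)-(\mathbf{X}^*,\mathbf{y}^*,\boldsymbol\lambda^* )\|$.
   Context: $\mathbb{S}^n$ is the space of $n\times n$ real symmetric matrices, $\mathbb{S}^n_+$ the positive semidefinite (PSD) ones, $\mathbb{S}^n_{++}$ the positive definite ones; $[d]=\{1,\dots,d\}$. Eigenvalues are ordered $\lambda_1(\cdot)\ge\dots\ge\lambda_n(\cdot)$. $f:\mathbb{S}^n\to\mathbb{R}$ is convex and $\beta$-smooth (its gradient is $\beta$-Lipschitz in Frobenius norm); $g=(g_1,\dots,g_d)^\top$ where each $g_i:\mathbb{S}^n\to\mathbb{R}$ is convex and $\beta_g$-smooth; $\mathbf{b}\in\mathbb{R}^m$, and $\mathcal{A}:\mathbb{S}^n\to\mathbb{R}^m$ is the linear map $\mathcal{A}(\mathbf{X})=(\langle\mathbf{X},\mathbf{A}_1\rangle,\dots,\langle\mathbf{X},\mathbf{A}_m\rangle)^\top$ with $\mathbf{A}_i\in\mathbb{S}^n$; $\mathcal{A}^\top(\mathbf{y})=\sum_i\mathbf{y}_i\mathbf{A}_i$ and $\|\mathcal{A}\|:=\max\{\|\mathcal{A}(\mathbf{X})\|_2:\|\mathbf{X}\|_F\le1\}$. Norms of tuples are Euclidean norms on the product space. Standing assumptions: there is $\mathbf{X}_{\mathrm{S}}\in\mathbb{S}^n_{++}$ with $g_i(\mathbf{X}_{\mathrm{S}})<0$ for all $i\in[d]$ and $\mathcal{A}(\mathbf{X}_{\mathrm{S}})=\mathbf{b}$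 (Slater), and the minimization problem is bounded from below. Lagrangian: $\mathcal{L}(\mathbf{X},\mathbf{y},\boldsymbol\lambda):=f(\mathbf{X})+\boldsymbol\lambda^\top g(\mathbf{X})+\mathbf{y}^\top(\mathbf{b}-\mathcal{A}(\mathbf{X}))$. A dual solution $(\mathbf{y}^*,\boldsymbol\lambda^* )$ corresponding to $\mathbf{X}^*$ is one for which $(\mathbf{X}^*,(\mathbf{y}^*,\boldsymbol\lambda^* ))$ is a saddle-point of $\min_{\mathbf{X}\succeq0}\max_{\mathbf{y}\in\mathbb{R}^m,\boldsymbol\lambda\in\mathbb{R}^d_+}\mathcal{L}(\mathbf{X},\mathbf{y},\boldsymbol\lambda)$. For $\mathbf{X}\in\mathbb{S}^n$ with eigen-decomposition $\mathbf{X}=\sum_{i=1}^n\lambda_i\mathbf{v}_i\mathbf{v}_i^\top$, $\lambda_1\ge\dots\ge\lambda_n$, the Euclidean projection onto the PSD cone is $\Pi_{\mathbb{S}^n_+}[\mathbf{X}]=\sum_{i=1}^n\max\{\lambda_i,0\}\mathbf{v}_i\mathbf{v}_i^\top$, and the rank-$r$ truncated projection is $\widehat\Pi^r_{\mathbb{S}^n_+}[\mathbf{X}]:=\sum_{i=1}^r\max\{\lambda_i,0\}\mathbf{v}_i\mathbf{v}_i^\top$. Extragradient method with step-size $\eta>0$ (with $\Pi_{\mathbb{R}^d_+}$ the Euclidean projection onto $\mathbb{R}^d_+$): start from $(\mathbf{X}_1,\mathbf{y}_1,\boldsymbol\lambda_1)\in\mathbb{S}^n_+\times\mathbb{R}^m\times\mathbb{R}^d_+$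 and for $t=1,2,\dots$ set $\mathbf{Z}_{t+1}=\Pi_{\mathbb{S}^n_+}[\mathbf{X}_t-\eta\nabla_{\mathbf{X}}\mathcal{L}(\mathbf{X}_t,\mathbf{y}_t,\boldsymbol\lambda_t)]$, $\mathbf{w}_{t+1}=\mathbf{y}_t+\eta\nabla_{\mathbf{y}}\mathcal{L}(\mathbf{X}_t,\mathbf{y}_t,\boldsymbol\lambda_t)$, $\boldsymbol\mu_{t+1}=\Pi_{\mathbb{R}^d_+}[\boldsymbol\lambda_t+\eta\nabla_{\boldsymbol\lambda}\mathcal{L}(\mathbf{X}_t,\mathbf{y}_t,\boldsymbol\lambda_t)]$, $\mathbf{X}_{t+1}=\Pi_{\mathbb{S}^n_+}[\mathbf{X}_t-\eta\nabla_{\mathbf{X}}\mathcal{L}(\mathbf{Z}_{t+1},\mathbf{w}_{t+1},\boldsymbol\mu_{t+1})]$, $\mathbf{y}_{t+1}=\mathbf{y}_t+\eta\nabla_{\mathbf{y}}\mathcal{L}(\mathbf{Z}_{t+1},\mathbf{w}_{t+1},\boldsymbol\mu_{t+1})$, $\boldsymbol\lambda_{t+1}=\Pi_{\mathbb{R}^d_+}[\boldsymbol\lambda_t+\eta\nabla_{\boldsymbol\lambda}\mathcal{L}(\mathbf{Z}_{t+1},\mathbf{w}_{t+1},\boldsymbol\mu_{t+1})]$. The rank parameter $r$ and $\tilde r$ are such that the eigenvalue indices appearing are in $\{1,\dots,n\}$. A bound with $\|\mathbf{y}^*\|_2$ in the denominator is vacuous if $\mathbf{y}^*=0$. *)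

theory Defs
  imports "HOL-Analysis.Analysis" "HOL-Computational_Algebra.Polynomial"
begin

text \<open>
  An \<open>n \<times> n\<close> real matrix has type \<^typ>\<open>real^'n^'n\<close> with \<open>n = CARD('n)\<close>. On this type the library's
  inner product is the trace inner product and its norm is the Frobenius norm; the norm on
  (nested) pairs is the Euclidean norm of the product space. Functions on symmetric matrices are
  total functions on matrices of which only the values on \<open>sym_mats\<close> are used.
\<close>

definition sym_mats :: "(real^'n^'n) set" where
  "sym_mats = {X. transpose X = X}"

definition psd_mats :: "(real^'n^'n) set" where
  "psd_mats = {X \<in> sym_mats. \<forall>x. 0 \<le> x \<bullet> (X *v x)}"

definition pd_mats :: "(real^'n^'n) set" where
  "pd_mats = {X \<in> sym_mats. \<forall>x. x \<noteq> 0 \<longrightarrow> 0 < x \<bullet> (X *v x)}"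

definition nonneg_vecs :: "(real^'d) set" where
  "nonneg_vecs = {l. \<forall>i. 0 \<le> l $ i}"


section \<open>Ordered eigenvalues and projections\<close>

definition charpoly :: "real^'n^'n \<Rightarrow> real poly" where
  "charpoly X = det ((\<chi> i j. (if i = j then [:0, 1:] else 0) - [:X $ i $ j:]) :: (real poly)^'n^'n)"

text \<open>
  \<open>eigval X i\<close> is the \<open>i\<close>-th largest eigenvalue, \<open>1 \<le> i \<le> n\<close>, counted with multiplicity. Intended
  for symmetric \<open>X\<close>, whose characteristic polynomial has \<open>n\<close> real roots.
\<close>
definition eigval :: "real^'n^'n \<Rightarrow> nat \<Rightarrow> real" where
  "eigval X i = rev (sorted_list_of_multiset (proots (charpoly X))) ! (i - 1)"

definition outer :: "real^'n \<Rightarrow> real^'n^'n" where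
  "outer v = (\<chi> i j. v $ i * v $ j)"

definition eigen_decomposition :: "real^'n^'n \<Rightarrow> (nat \<Rightarrow> real^'n) \<Rightarrow> bool" where
  "eigen_decomposition X v \<longleftrightarrow>
     (\<forall>i\<in>{1..CARD('n)}. \<forall>j\<in>{1..CARD('n)}. v i \<bullet> v j = (if i = j then 1 else 0)) \<and>
     X = (\<Sum>i=1..CARD('n). eigval X i *\<^sub>R outer (v i))"

text \<open>
  Projections are relations between the input \<open>M\<close> and the output \<open>P\<close>: the rank-\<open>r\<close> truncated
  projection depends on the chosen eigenvectors if \<open>eigval M r = eigval M (r + 1) > 0\<close>.
\<close>
definition is_psd_proj :: "real^'n^'n \<Rightarrow> real^'n^'n \<Rightarrow> bool" where
  "is_psd_proj M P \<longleftrightarrow> P = closest_point psd_mats M"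

definition is_trunc_proj :: "nat \<Rightarrow> real^'n^'n \<Rightarrow> real^'n^'n \<Rightarrow> bool" where
  "is_trunc_proj r M P \<longleftrightarrow>
     (\<exists>v. eigen_decomposition M v \<and> P = (\<Sum>i=1..r. max (eigval M i) 0 *\<^sub>R outer (v i)))"


section \<open>Gradients on a subspace\<close>

definition is_gradient :: "'a::euclidean_space set \<Rightarrow> ('a \<Rightarrow> real) \<Rightarrow> 'a \<Rightarrow> 'a \<Rightarrow> bool" where
  "is_gradient S f x D \<longleftrightarrow> D \<in> S \<and> (f has_derivative (\<lambda>h. h \<bullet> D)) (at x within S)"

definition gradient :: "'a::euclidean_space set \<Rightarrow> ('a \<Rightarrow> real) \<Rightarrow> 'a \<Rightarrow> 'a" where
  "gradient S f x = (THE D. is_gradient S f x D)"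

definition smooth_on :: "'a::euclidean_space set \<Rightarrow> real \<Rightarrow> ('a \<Rightarrow> real) \<Rightarrow> bool" where
  "smooth_on S \<beta> f \<longleftrightarrow> (\<forall>x\<in>S. \<exists>D. is_gradient S f x D) \<and> lipschitz_on \<beta> S (gradient S f)"


section \<open>The optimization problem and its Lagrangian\<close>

definition lin_op :: "('m \<Rightarrow> real^'n^'n) \<Rightarrow> real^'n^'n \<Rightarrow> real^'m" where
  "lin_op A X = (\<chi> i. X \<bullet> A i)"

definition lin_op_adj :: "('m::finite \<Rightarrow> real^'n^'n) \<Rightarrow> real^'m \<Rightarrow> real^'n^'n" where
  "lin_op_adj A y = (\<Sum>i\<in>UNIV. y $ i *\<^sub>R A i)"

definition lin_op_norm :: "('m::finite \<Rightarrow> real^'n^'n) \<Rightarrow> real" where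
  "lin_op_norm A = (SUP X\<in>{X \<in> sym_mats. norm X \<le> 1}. norm (lin_op A X))"

definition feasible :: "(real^'n^'n \<Rightarrow> real^'d) \<Rightarrow> ('m \<Rightarrow> real^'n^'n) \<Rightarrow> real^'m \<Rightarrow> (real^'n^'n) set" where
  "feasible g A b = {X \<in> psd_mats. lin_op A X = b \<and> (\<forall>i. g X $ i \<le> 0)}"

definition optimal_solution ::
  "(real^'n^'n \<Rightarrow> real) \<Rightarrow> (real^'n^'n \<Rightarrow> real^'d) \<Rightarrow> ('m \<Rightarrow> real^'n^'n) \<Rightarrow> real^'m \<Rightarrow> real^'n^'n \<Rightarrow> bool"
  where
  "optimal_solution f g A b X \<longleftrightarrow> X \<in> feasible g A b \<and> (\<forall>Y\<in>feasible g A b. f X \<le> f Y)"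

definition lagrangian ::
  "(real^'n^'n \<Rightarrow> real) \<Rightarrow> (real^'n^'n \<Rightarrow> real^'d) \<Rightarrow> ('m \<Rightarrow> real^'n^'n) \<Rightarrow> real^'m \<Rightarrow>
   real^'n^'n \<Rightarrow> real^'m \<Rightarrow> real^'d \<Rightarrow> real" where
  "lagrangian f g A b X y l = f X + l \<bullet> g X + y \<bullet> (b - lin_op A X)"

definition dual_solution ::
  "(real^'n^'n \<Rightarrow> real^'m \<Rightarrow> real^'d \<Rightarrow> real) \<Rightarrow> real^'n^'n \<Rightarrow> real^'m \<Rightarrow> real^'d \<Rightarrow> bool" where
  "dual_solution L Xs ys ls \<longleftrightarrow> Xs \<in> psd_mats \<and> ls \<in> nonneg_vecs \<and>
     (\<forall>y. \<forall>l\<in>nonneg_vecs. L Xs y l \<le> L Xs ys ls) \<and> (\<forall>X\<in>psd_mats. L Xs ys ls \<le> L X ys ls)"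

definition grad_X :: "(real^'n^'n \<Rightarrow> real^'m \<Rightarrow> real^'d \<Rightarrow> real) \<Rightarrow> real^'n^'n \<Rightarrow> real^'m \<Rightarrow> real^'d \<Rightarrow> real^'n^'n" where
  "grad_X L X y l = gradient sym_mats (\<lambda>X. L X y l) X"

definition grad_y :: "(real^'n^'n \<Rightarrow> real^'m \<Rightarrow> real^'d \<Rightarrow> real) \<Rightarrow> real^'n^'n \<Rightarrow> real^'m \<Rightarrow> real^'d \<Rightarrow> real^'m" where
  "grad_y L X y l = gradient UNIV (\<lambda>y. L X y l) y"

definition grad_l :: "(real^'n^'n \<Rightarrow> real^'m \<Rightarrow> real^'d \<Rightarrow> real) \<Rightarrow> real^'n^'n \<Rightarrow> real^'m \<Rightarrow> real^'d \<Rightarrow> real^'d" where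
  "grad_l L X y l = gradient UNIV (\<lambda>l. L X y l) l"


section \<open>The extragradient method\<close>

text \<open>
  \<open>proj M P\<close> says that \<open>P\<close> is a projection of \<open>M\<close> onto the PSD cone. Only the entries
  \<open>t \<ge> 1\<close> of \<open>X, y, l\<close> and \<open>t \<ge> 2\<close> of \<open>Z, w, \<mu>\<close> are constrained.
\<close>
definition extragradient ::
  "(real^'n^'n \<Rightarrow> real^'n^'n \<Rightarrow> bool) \<Rightarrow> (real^'n^'n \<Rightarrow> real^'m \<Rightarrow> real^'d \<Rightarrow> real) \<Rightarrow> real \<Rightarrow>
   (nat \<Rightarrow> real^'n^'n) \<Rightarrow> (nat \<Rightarrow> real^'m) \<Rightarrow> (nat \<Rightarrow> real^'d) \<Rightarrow>
   (nat \<Rightarrow> real^'n^'n) \<Rightarrow> (nat \<Rightarrow> real^'m) \<Rightarrow> (nat \<Rightarrow> real^'d) \<Rightarrow> bool" where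
  "extragradient proj L \<eta> X y l Z w \<mu> \<longleftrightarrow>
     X 1 \<in> psd_mats \<and> l 1 \<in> nonneg_vecs \<and>
     (\<forall>t\<ge>1.
        proj (X t - \<eta> *\<^sub>R grad_X L (X t) (y t) (l t)) (Z (t + 1)) \<and>
        w (t + 1) = y t + \<eta> *\<^sub>R grad_y L (X t) (y t) (l t) \<and>
        \<mu> (t + 1) = closest_point nonneg_vecs (l t + \<eta> *\<^sub>R grad_l L (X t) (y t) (l t)) \<and>
        proj (X t - \<eta> *\<^sub>R grad_X L (Z (t + 1)) (w (t + 1)) (\<mu> (t + 1))) (X (t + 1)) \<and>
        y (t + 1) = y t + \<eta> *\<^sub>R grad_y L (Z (t + 1)) (w (t + 1)) (\<mu> (t + 1)) \<and>
        l (t + 1) = closest_point nonneg_vecs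
          (l t + \<eta> *\<^sub>R grad_l L (Z (t + 1)) (w (t + 1)) (\<mu> (t + 1))))"


section \<open>Closed forms of the gradients of the Lagrangian\<close>

lemma subspace_sym_mats: "subspace sym_mats"
  by (auto simp: subspace_def sym_mats_def transpose_def vec_eq_iff)

lemma gradient_eqI:
  assumes "subspace S" "x \<in> S" "is_gradient S f x D"
  shows "gradient S f x = D"
  unfolding gradient_def
proof (rule the_equality, rule assms(3))
  fix E assume E: "is_gradient S f x E"
  have DE: "D - E \<in> S"
    using E assms by (auto simp: is_gradient_def subspace_diff)
  define \<phi> where "\<phi> = (\<lambda>s::real. x + s *\<^sub>R (D - E))"
  have \<phi>: "(\<phi> has_derivative (\<lambda>s. s *\<^sub>R (D - E))) (at 0)"
    unfolding \<phi>_def by (auto intro!: derivative_eq_intros)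
  have im: "range \<phi> \<subseteq> S"
    using assms(1,2) DE by (auto simp: \<phi>_def subspace_add subspace_scale)
  have "((\<lambda>s. f (\<phi> s)) has_derivative (\<lambda>s. (s *\<^sub>R (D - E)) \<bullet> G)) (at 0)"
    if "is_gradient S f x G" for G
  proof -
    have "(f has_derivative (\<lambda>h. h \<bullet> G)) (at (\<phi> 0) within range \<phi>)"
      using that im has_derivative_subset by (auto simp: is_gradient_def \<phi>_def)
    from has_derivative_in_compose[OF \<phi> this] show ?thesis .
  qed
  from has_derivative_unique[OF this[OF assms(3)] this[OF E]]
  have "1 *\<^sub>R (D - E) \<bullet> D = 1 *\<^sub>R (D - E) \<bullet> E" by metis
  then have "(D - E) \<bullet> (D - E) = 0" by (simp add: inner_diff_right)
  then show "E = D" by simp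
qed

lemma is_gradient_gradient:
  assumes "subspace S" "x \<in> S" "smooth_on S \<beta> f"
  shows "is_gradient S f x (gradient S f x)"
  using assms gradient_eqI unfolding smooth_on_def by metis

lemma grad_X_lagrangian:
  fixes g :: "real^'n^'n \<Rightarrow> real^'d" and A :: "'m::finite \<Rightarrow> real^'n^'n"
  assumes "X \<in> sym_mats" "smooth_on sym_mats \<beta> f"
    and "\<And>i. smooth_on sym_mats \<beta>g (\<lambda>X. g X $ i)" and A: "\<And>i. A i \<in> sym_mats"
  shows "grad_X (lagrangian f g A b) X y l =
    gradient sym_mats f X - lin_op_adj A y
      + (\<Sum>i\<in>UNIV. l $ i *\<^sub>R gradient sym_mats (\<lambda>X. g X $ i) X)"
  unfolding grad_X_def
proof (rule gradient_eqI[OF subspace_sym_mats assms(1)])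
  note F = is_gradient_gradient[OF subspace_sym_mats assms(1,2)]
  note G = is_gradient_gradient[OF subspace_sym_mats assms(1,3)]
  have lag: "(\<lambda>X. lagrangian f g A b X y l) =
    (\<lambda>X. f X + (\<Sum>i\<in>UNIV. l $ i * g X $ i) + (\<Sum>i\<in>UNIV. y $ i * (b $ i - X \<bullet> A i)))"
    by (simp add: lagrangian_def inner_vec_def lin_op_def)
  have "((\<lambda>X. lagrangian f g A b X y l) has_derivative
     (\<lambda>h. h \<bullet> gradient sym_mats f X
        + (\<Sum>i\<in>UNIV. l $ i * (h \<bullet> gradient sym_mats (\<lambda>X. g X $ i) X))
        + (\<Sum>i\<in>UNIV. y $ i * (0 - h \<bullet> A i)))) (at X within sym_mats)"
    unfolding lag using F G
    by (intro has_derivative_add has_derivative_sum has_derivative_mult_right has_derivative_diff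
        has_derivative_const has_derivative_inner_left has_derivative_ident)
       (auto simp: is_gradient_def)
  moreover have "gradient sym_mats f X - lin_op_adj A y
      + (\<Sum>i\<in>UNIV. l $ i *\<^sub>R gradient sym_mats (\<lambda>X. g X $ i) X) \<in> sym_mats"
    using F G A unfolding is_gradient_def lin_op_adj_def
    by (intro subspace_add subspace_diff subspace_sum subspace_scale subspace_sym_mats) auto
  ultimately show "is_gradient sym_mats (\<lambda>X. lagrangian f g A b X y l) X
     (gradient sym_mats f X - lin_op_adj A y
      + (\<Sum>i\<in>UNIV. l $ i *\<^sub>R gradient sym_mats (\<lambda>X. g X $ i) X))"
    unfolding is_gradient_def
    by (simp add: inner_add_right inner_diff_right lin_op_adj_def inner_sum_right sum_negf)
       (simp add: algebra_simps)
qed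

lemma grad_y_lagrangian: "grad_y (lagrangian f g A b) X y l = b - lin_op A X"
  unfolding grad_y_def lagrangian_def
  by (rule gradient_eqI) (auto simp: is_gradient_def intro!: derivative_eq_intros)

lemma grad_l_lagrangian: "grad_l (lagrangian f g A b) X y l = g X"
  unfolding grad_l_def lagrangian_def
  by (rule gradient_eqI) (auto simp: is_gradient_def intro!: derivative_eq_intros)

end

theory Submission
  imports Defs
begin

text \<open>
  The extragradient iterates never leave the ball of radius \<open>2\<delta>\<close> around the saddle point: there the
  scaled saddle operator \<open>\<Phi> = \<eta> (grad_X L, - grad_y L, - grad_l L)\<close> is monotone and Lipschitz with squared
  constant \<open>2/3\<close>, so one step decreases the distance to the saddle point. Inside the ball every matrix
  that is projected differs from \<open>Xs - \<eta> GL\<close> by at most \<open>\<eta> \<delta>\<close>; by complementarity of \<open>Xs\<close> and \<open>GL\<close> and a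
  Weyl-type argument it has at most \<open>r\<close> positive eigenvalues, hence truncation changes nothing.

  The ergodic rates come from summing the descent inequality and choosing test points in \<open>C_y\<close> and
  \<open>C_l\<close>. For the last iterate, the tangent residual of the iterates is nonincreasing and its square is
  bounded by a multiple of each decrease of the squared distance, which gives the rate \<open>1/sqrt T\<close> for
  the residual; convexity converts the residual into the stated bounds.
\<close>

section \<open>Extragradient steps for monotone operators\<close>

text \<open>The obstacle is that the operator is Lipschitz only locally: \<open>\<Lambda>\<close>
  and \<open>\<Gamma>\<close> are suprema over balls of radius \<open>2 * \<delta>\<close>. The half
  step must therefore be localised before any Lipschitz bound may be applied to it. Nonexpansiveness
  of the projection does this at the cost of a factor 2 in the distance, which fits the radius of
  those balls.

  The constants of the last-iterate estimate leave little slack. The squared half step costs 13/3,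
  passing from the half step to the gap costs 5/3, and their product 65/9 fits below 8, the square
  of the factor \<open>2 * sqrt 2\<close> that remains of \<open>3 * sqrt 2\<close> in
  \<open>R1\<close> once 3/2 is spent on the distance to the test point. The cruder triangle
  inequality in place of monotonicity would exceed it.

  The two entries of the maximum in \<open>\<delta>\<close> are the cases \<open>k = 1\<close> and
  \<open>k = rt\<close> of a single perturbation bound.\<close>

definition proj_point :: "'a::real_inner set \<Rightarrow> 'a \<Rightarrow> 'a \<Rightarrow> bool" where
  "proj_point K a p \<longleftrightarrow> p \<in> K \<and> (\<forall>v\<in>K. (a - p) \<bullet> (v - p) \<le> 0)"

lemma proj_pointD: "proj_point K a p \<Longrightarrow> v \<in> K \<Longrightarrow> (a - p) \<bullet> (v - p) \<le> 0"
  by (simp add: proj_point_def)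

lemma proj_point_mem: "proj_point K a p \<Longrightarrow> p \<in> K"
  by (simp add: proj_point_def)

lemma proj_point_closest_point:
  fixes K :: "'a::euclidean_space set"
  assumes "closed K" "convex K" "K \<noteq> {}"
  shows "proj_point K a (closest_point K a)"
  using assms by (auto simp: proj_point_def closest_point_in_set closest_point_dot)

text \<open>The variational form of projection splits over products, so the separate projections of
  the method become one projection onto a product cone.\<close>

lemma proj_point_Times:
  "proj_point S a p \<Longrightarrow> proj_point T b q \<Longrightarrow> proj_point (S \<times> T) (a, b) (p, q)"
  by (force simp: proj_point_def)

lemma proj_point_nonexpansive:
  assumes "proj_point K a p" "proj_point K b q"
  shows "norm (p - q) \<le> norm (a - b)"
proof -
  have "(a - p) \<bullet> (q - p) \<le> 0" "(b - q) \<bullet> (p - q) \<le> 0"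
    using assms proj_pointD proj_point_mem by blast+
  then have "(norm (p - q))\<^sup>2 \<le> (a - b) \<bullet> (p - q)"
    by (simp add: power2_norm_eq_inner inner_simps inner_commute)
  also have "\<dots> \<le> norm (a - b) * norm (p - q)"
    by (rule norm_cauchy_schwarz)
  finally show ?thesis
    by (cases "p = q") (auto simp: power2_eq_square)
qed

lemma proj_point_unique: "proj_point K a p \<Longrightarrow> proj_point K a q \<Longrightarrow> p = q"
  using proj_point_nonexpansive[of K a p a q] by simp

lemma sqrt_bound_mult_le:
  fixes a b c :: real
  assumes "a\<^sup>2 \<le> c * b\<^sup>2" "0 \<le> b" "0 \<le> c"
  shows "a \<le> sqrt c * b"
  using real_le_rsqrt[OF assms(1)] assms by (simp add: real_sqrt_mult)

text \<open>The cross term is nonpositive. This gives \<open>1 + k\<close> where the triangle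
  inequality would give \<open>(1 + sqrt k)\<^sup>2\<close>.\<close>

lemma norm_diff_sq_le_of_monotone:
  fixes a d :: "'a::real_inner"
  assumes "0 \<le> a \<bullet> d" "(norm d)\<^sup>2 \<le> k * (norm a)\<^sup>2"
  shows "(norm (a - d))\<^sup>2 \<le> (1 + k) * (norm a)\<^sup>2"
  using assms by (simp add: power2_norm_eq_inner inner_simps inner_commute algebra_simps)

section \<open>A single extragradient step\<close>

locale eg_step =
  fixes K :: "'a::real_inner set" and \<Phi> :: "'a \<Rightarrow> 'a" and u z u' :: 'a
  assumes u_mem: "u \<in> K"
    and z_proj: "proj_point K (u - \<Phi> u) z"
    and u'_proj: "proj_point K (u - \<Phi> z) u'"
    and mono: "\<And>x y. x \<in> K \<Longrightarrow> y \<in> K \<Longrightarrow> 0 \<le> (\<Phi> x - \<Phi> y) \<bullet> (x - y)"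
    and lip: "(norm (\<Phi> u - \<Phi> z))\<^sup>2 \<le> 2 / 3 * (norm (u - z))\<^sup>2"
begin

lemma z_mem: "z \<in> K" and u'_mem: "u' \<in> K"
  using z_proj u'_proj by (auto simp: proj_point_mem)

definition gain :: real where
  "gain = (norm (u - z))\<^sup>2 + (norm (u' - z))\<^sup>2 - 2 * ((\<Phi> u - \<Phi> z) \<bullet> (u' - z))"

text \<open>The projection inequality of \<open>z\<close> is tested at \<open>u'\<close>, that of
  \<open>u'\<close> at \<open>v\<close>; their sum, after expanding the squares, is the
  claim.\<close>

lemma descent:
  assumes "v \<in> K"
  shows "(norm (u' - v))\<^sup>2 \<le> (norm (u - v))\<^sup>2 - 2 * (\<Phi> z \<bullet> (z - v)) - gain"
proof -
  have "(u - \<Phi> u - z) \<bullet> (u' - z) \<le> 0" "(u - \<Phi> z - u') \<bullet> (v - u') \<le> 0"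
    using proj_pointD z_proj u'_proj u'_mem assms by blast+
  then show ?thesis
    by (simp add: gain_def power2_norm_eq_inner inner_simps inner_commute algebra_simps)
qed

text \<open>Completing the square in \<open>u' - z\<close> leaves
  \<open>- (norm (\<Phi> u - \<Phi> z))\<^sup>2\<close>, and the Lipschitz bound pays for it with
  two thirds of the squared half step.\<close>

lemma gain_ge: "(norm (u - z))\<^sup>2 / 3 + (norm (u' - z - (\<Phi> u - \<Phi> z)))\<^sup>2 \<le> gain"
proof -
  have "gain = (norm (u - z))\<^sup>2 - (norm (\<Phi> u - \<Phi> z))\<^sup>2 + (norm (u' - z - (\<Phi> u - \<Phi> z)))\<^sup>2"
    by (simp add: gain_def power2_norm_eq_inner inner_simps inner_commute algebra_simps)
  then show ?thesis using lip by linarith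
qed

lemma gain_nonneg: "0 \<le> gain"
  using gain_ge zero_le_power2[of "norm (u - z)"] zero_le_power2[of "norm (u' - z - (\<Phi> u - \<Phi> z))"]
  by linarith

lemma half_step_sq_le_gain: "(norm (u - z))\<^sup>2 \<le> 3 * gain"
  using gain_ge zero_le_power2[of "norm (u' - z - (\<Phi> u - \<Phi> z))"] by linarith

lemma correction_le: "norm (u' - z) \<le> norm (\<Phi> u - \<Phi> z)"
  using proj_point_nonexpansive[OF u'_proj z_proj] by simp

lemma residual_sq_le_gain:
  assumes lip': "(norm (\<Phi> z - \<Phi> u'))\<^sup>2 \<le> 2 / 3 * (norm (z - u'))\<^sup>2"
  shows "(norm (u - u' + \<Phi> u' - \<Phi> z))\<^sup>2 \<le> 13 / 3 * gain"
proof -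
  define a b d d' where "a = u - z" and "b = u' - z" and "d = \<Phi> u - \<Phi> z" and "d' = \<Phi> z - \<Phi> u'"
  have b: "(norm b)\<^sup>2 \<le> 2 / 3 * (norm a)\<^sup>2"
    using power_mono[OF correction_le norm_ge_zero, of 2] lip unfolding a_def b_def by linarith
  have d': "(norm d')\<^sup>2 \<le> 4 / 9 * (norm a)\<^sup>2"
    using b lip' by (simp add: a_def b_def d'_def norm_minus_commute)
  \<comment> \<open>Adding twice the monotonicity inequality between \<open>u\<close> and \<open>u'\<close> leaves a bound in terms of \<open>gain\<close>.\<close>
  have "0 \<le> (d + d') \<bullet> (a - b)"
    using mono[OF u_mem u'_mem] by (simp add: a_def b_def d_def d'_def)
  then have "(norm (a - b - d'))\<^sup>2 \<le> gain + (norm d')\<^sup>2 + 2 * (a \<bullet> (d - b))"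
    by (simp add: gain_def a_def[symmetric] b_def[symmetric] d_def[symmetric]
      power2_norm_eq_inner inner_simps inner_commute algebra_simps)
  moreover have "2 * (a \<bullet> (d - b)) \<le> 2 / 3 * (norm a)\<^sup>2 + 3 / 2 * (norm (b - d))\<^sup>2"
  proof -
    have "a \<bullet> (d - b) \<le> norm a * norm (b - d)"
      using norm_cauchy_schwarz[of a "d - b"] by (simp add: norm_minus_commute)
    moreover have "0 \<le> (2 * norm a - 3 * norm (b - d))\<^sup>2" by simp
    then have "12 * (norm a * norm (b - d)) \<le> 4 * (norm a)\<^sup>2 + 9 * (norm (b - d))\<^sup>2"
      by (simp add: power2_eq_square algebra_simps)
    ultimately show ?thesis by linarith
  qed
  moreover have "(norm a)\<^sup>2 / 3 + (norm (b - d))\<^sup>2 \<le> gain"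
    using gain_ge by (simp add: a_def b_def d_def)
  moreover have "0 \<le> (norm (b - d))\<^sup>2" by simp
  \<comment> \<open>The coefficient of \<open>(norm a)\<^sup>2\<close> is 4/9 + 2/3 = 10/9, which is
    10/3 times the 1/3 provided by \<open>gain\<close>, and 3/2 is below 10/3. The total is 1 + 10/3
    = 13/3 gains.\<close>
  ultimately have "(norm (a - b - d'))\<^sup>2 \<le> 13 / 3 * gain"
    using d' by linarith
  moreover have "a - b - d' = u - u' + \<Phi> u' - \<Phi> z"
    by (simp add: a_def b_def d'_def)
  ultimately show ?thesis by simp
qed

text \<open>
  For a normal vector \<open>c\<close> of \<open>K\<close> at \<open>u\<close>, the right-hand side is the tangent residual at \<open>u\<close>; on the
  left stands the one at \<open>u'\<close> for the normal vector produced by the projection.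
\<close>
lemma residual_decreasing:
  assumes lip': "(norm (\<Phi> z - \<Phi> u'))\<^sup>2 \<le> (norm (z - u'))\<^sup>2"
    and c: "\<And>v. v \<in> K \<Longrightarrow> c \<bullet> (v - u) \<le> 0"
  shows "norm (u - u' + \<Phi> u' - \<Phi> z) \<le> norm (\<Phi> u + c)"
proof -
  define G where "G = \<Phi> u + c"
  define G' where "G' = u - u' + \<Phi> u' - \<Phi> z"
  define \<zeta> where "\<zeta> = u - z - \<Phi> u"
  have c': "(u - \<Phi> z - u') \<bullet> (u - u') \<le> 0" using proj_pointD[OF u'_proj u_mem] .
  have cz: "c \<bullet> (z - u) \<le> 0" using c z_mem .
  have z': "(u - \<Phi> u - z) \<bullet> (u' - z) \<le> 0" using proj_pointD[OF z_proj u'_mem] .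
  have m: "0 \<le> (\<Phi> u - \<Phi> u') \<bullet> (u - u')" using mono u_mem u'_mem .
  have lip'': "(norm (\<Phi> u' - \<Phi> z))\<^sup>2 \<le> (norm (u' - z))\<^sup>2"
    using lip' by (simp add: norm_minus_commute)
  \<comment> \<open>Every group on the right is nonnegative: monotonicity, normality of
    \<open>c\<close>, the two projection inequalities, the Lipschitz difference and a
    square.\<close>
  have "(norm G)\<^sup>2 - (norm G')\<^sup>2 =
      2 * ((\<Phi> u - \<Phi> u') \<bullet> (u - u')) - 2 * ((u - \<Phi> z - u') \<bullet> (u - u')) - 2 * (c \<bullet> (z - u))
      - 2 * ((u - \<Phi> u - z) \<bullet> (u' - z)) + (norm (u' - z))\<^sup>2 - (norm (\<Phi> u' - \<Phi> z))\<^sup>2 + (norm (c - \<zeta>))\<^sup>2"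
    by (simp add: G_def G'_def \<zeta>_def power2_norm_eq_inner inner_simps inner_commute algebra_simps)
  then have "(norm G')\<^sup>2 \<le> (norm G)\<^sup>2"
    using c' cz z' m lip'' zero_le_power2[of "norm (c - \<zeta>)"] by linarith
  then have "norm G' \<le> norm G"
    by (rule power2_le_imp_le) simp
  then show ?thesis unfolding G_def G'_def .
qed

text \<open>The natural residual \<open>u - z\<close> is dominated by the tangent residual: the
  projection inequality of \<open>z\<close> at \<open>u\<close> and normality of \<open>c\<close> at
  \<open>z\<close> add up to a bound for its square.\<close>

lemma half_step_le_residual:
  assumes c: "\<And>v. v \<in> K \<Longrightarrow> c \<bullet> (v - u) \<le> 0"
  shows "norm (u - z) \<le> norm (\<Phi> u + c)"
proof -
  have "(u - \<Phi> u - z) \<bullet> (u - z) \<le> 0" "c \<bullet> (z - u) \<le> 0"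
    using proj_pointD[OF z_proj u_mem] c[OF z_mem] by auto
  then have "(norm (u - z))\<^sup>2 \<le> (\<Phi> u + c) \<bullet> (u - z)"
    by (simp add: power2_norm_eq_inner inner_simps inner_commute algebra_simps)
  also have "\<dots> \<le> norm (\<Phi> u + c) * norm (u - z)"
    by (rule norm_cauchy_schwarz)
  finally show ?thesis
    by (cases "u = z") (auto simp: power2_eq_square)
qed

text \<open>The projection inequality of \<open>z\<close> replaces \<open>\<Phi> z\<close> by
  \<open>u - z - (\<Phi> u - \<Phi> z)\<close>; monotonicity keeps the norm of this vector below
  \<open>sqrt (1 + 2 / 3)\<close> half steps.\<close>

lemma gap_le_half_step:
  assumes "v \<in> K"
  shows "\<Phi> z \<bullet> (z - v) \<le> sqrt (5 / 3) * norm (u - z) * norm (z - v)"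
proof -
  have "0 \<le> (u - z) \<bullet> (\<Phi> u - \<Phi> z)"
    using mono[OF u_mem z_mem] by (simp add: inner_commute)
  from norm_diff_sq_le_of_monotone[OF this lip]
  have "norm (u - z - (\<Phi> u - \<Phi> z)) \<le> sqrt (5 / 3) * norm (u - z)"
    by (intro sqrt_bound_mult_le) auto
  moreover have "\<Phi> z \<bullet> (z - v) \<le> (u - z - (\<Phi> u - \<Phi> z)) \<bullet> (z - v)"
    using proj_pointD[OF z_proj assms] by (simp add: inner_simps algebra_simps)
  ultimately show ?thesis
    using norm_cauchy_schwarz[of "u - z - (\<Phi> u - \<Phi> z)" "z - v"]
      mult_right_mono[OF _ norm_ge_zero[of "z - v"]] by force
qed

end

section \<open>Iteration near a solution of the variational inequality\<close>

locale eg_iteration =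
  fixes K :: "'a::real_inner set" and \<Phi> :: "'a \<Rightarrow> 'a" and p :: 'a and R :: real and u z :: "nat \<Rightarrow> 'a"
  assumes mono: "\<And>x y. x \<in> K \<Longrightarrow> y \<in> K \<Longrightarrow> 0 \<le> (\<Phi> x - \<Phi> y) \<bullet> (x - y)"
    and lip: "\<And>x y. \<lbrakk>x \<in> K; y \<in> K; norm (x - p) \<le> 2 * R; norm (y - p) \<le> 2 * R\<rbrakk>
      \<Longrightarrow> (norm (\<Phi> x - \<Phi> y))\<^sup>2 \<le> 2 / 3 * (norm (x - y))\<^sup>2"
    and p_mem: "p \<in> K" and p_sol: "\<And>v. v \<in> K \<Longrightarrow> 0 \<le> \<Phi> p \<bullet> (v - p)"
    and init: "u 1 \<in> K" "norm (u 1 - p) \<le> R"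
    and z_proj: "\<And>t. t \<ge> 1 \<Longrightarrow> proj_point K (u t - \<Phi> (u t)) (z (Suc t))"
    and u_proj: "\<And>t. t \<ge> 1 \<Longrightarrow> proj_point K (u t - \<Phi> (z (Suc t))) (u (Suc t))"
begin

lemma R_nonneg: "0 \<le> R"
  by (rule order_trans[OF norm_ge_zero init(2)])

lemma u_mem: "t \<ge> 1 \<Longrightarrow> u t \<in> K"
  using init(1) proj_point_mem[OF u_proj[of "t - 1"]] by (cases "t = 1") auto

lemma z_mem: "t \<ge> 1 \<Longrightarrow> z (Suc t) \<in> K"
  by (rule proj_point_mem[OF z_proj])

text \<open>Breaks the circularity of localisation: \<open>p\<close> is a fixed point of the
  projected step, so nonexpansiveness and the Lipschitz bound between \<open>u t\<close> and
  \<open>p\<close> suffice, with no such bound at \<open>z (Suc t)\<close>.\<close>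

lemma z_near:
  assumes "t \<ge> 1" "norm (u t - p) \<le> R"
  shows "norm (z (Suc t) - p) \<le> 2 * norm (u t - p)"
proof -
  have "norm (\<Phi> (u t) - \<Phi> p) \<le> norm (u t - p)"
  proof (rule power2_le_imp_le)
    have "(norm (\<Phi> (u t) - \<Phi> p))\<^sup>2 \<le> 2 / 3 * (norm (u t - p))\<^sup>2"
      using assms R_nonneg p_mem by (intro lip u_mem) auto
    then show "(norm (\<Phi> (u t) - \<Phi> p))\<^sup>2 \<le> (norm (u t - p))\<^sup>2"
      using zero_le_power2[of "norm (u t - p)"] by linarith
  qed simp
  moreover have "proj_point K (p - \<Phi> p) p"
    using p_mem p_sol by (simp add: proj_point_def)
  from proj_point_nonexpansive[OF z_proj[OF assms(1)] this]
  have "norm (z (Suc t) - p) \<le> norm ((u t - p) - (\<Phi> (u t) - \<Phi> p))"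
    by (simp add: algebra_simps)
  ultimately show ?thesis
    using norm_triangle_ineq4[of "u t - p" "\<Phi> (u t) - \<Phi> p"] by linarith
qed

lemma step: "t \<ge> 1 \<Longrightarrow> norm (u t - p) \<le> R \<Longrightarrow> eg_step K \<Phi> (u t) (z (Suc t)) (u (Suc t))"
  using z_near[of t] R_nonneg
  by unfold_locales (blast intro: u_mem z_proj u_proj mono | (rule lip; auto intro: u_mem z_mem))+

abbreviation gain :: "nat \<Rightarrow> real" where
  "gain t \<equiv> eg_step.gain \<Phi> (u t) (z (Suc t)) (u (Suc t))"

text \<open>Minty form of the variational inequality: monotonicity moves the operator from
  \<open>p\<close> to \<open>v\<close>.\<close>

lemma gap_p_nonneg:
  assumes "v \<in> K"
  shows "0 \<le> \<Phi> v \<bullet> (v - p)"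
  using mono[OF assms p_mem] p_sol[OF assms] by (simp add: inner_simps)

lemma descent_p:
  assumes "t \<ge> 1" "norm (u t - p) \<le> R"
  shows "gain t \<le> (norm (u t - p))\<^sup>2 - (norm (u (Suc t) - p))\<^sup>2" "0 \<le> gain t"
  using eg_step.descent[OF step[OF assms] p_mem] eg_step.gain_nonneg[OF step[OF assms]]
    gap_p_nonneg[OF z_mem[OF assms(1)]] by auto

lemma u_near: "t \<ge> 1 \<Longrightarrow> norm (u t - p) \<le> norm (u 1 - p)"
proof (induction t rule: dec_induct)
  case (step t)
  have "(norm (u (Suc t) - p))\<^sup>2 \<le> (norm (u t - p))\<^sup>2"
    using descent_p[OF step(1) order_trans[OF step(3) init(2)]] by linarith
  then have "norm (u (Suc t) - p) \<le> norm (u t - p)"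
    by (rule power2_le_imp_le) simp
  then show ?case using step(3) by linarith
qed simp

lemma u_near_R: "t \<ge> 1 \<Longrightarrow> norm (u t - p) \<le> R"
  by (rule order_trans[OF u_near init(2)])

lemma step_t: "t \<ge> 1 \<Longrightarrow> eg_step K \<Phi> (u t) (z (Suc t)) (u (Suc t))"
  by (rule step[OF _ u_near_R])

lemma z_near_init: "t \<ge> 1 \<Longrightarrow> norm (z (Suc t) - p) \<le> 2 * norm (u 1 - p)"
  using z_near[OF _ u_near_R] u_near[of t] by fastforce

lemma z_near_R: "t \<ge> 1 \<Longrightarrow> norm (z (Suc t) - p) \<le> 2 * R"
  using z_near_init[of t] init(2) by linarith

lemma lip_correction:
  assumes "t \<ge> 1"
  shows "(norm (\<Phi> (z (Suc t)) - \<Phi> (u (Suc t))))\<^sup>2 \<le> 2 / 3 * (norm (z (Suc t) - u (Suc t)))\<^sup>2"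
  using assms z_near_R u_near_R[of "Suc t"] R_nonneg by (intro lip u_mem z_mem) auto

lemma sum_gap_le:
  assumes "v \<in> K"
  shows "(\<Sum>t=1..T. \<Phi> (z (Suc t)) \<bullet> (z (Suc t) - v)) \<le> (norm (u 1 - v))\<^sup>2 / 2"
proof -
  have "2 * (\<Sum>t=1..T. \<Phi> (z (Suc t)) \<bullet> (z (Suc t) - v)) + (norm (u (Suc T) - v))\<^sup>2 \<le> (norm (u 1 - v))\<^sup>2"
  proof (induction T)
    case (Suc T)
    then show ?case
      using eg_step.descent[OF step_t[of "Suc T"] assms] eg_step.gain_nonneg[OF step_t[of "Suc T"]]
      by simp
  qed simp
  then show ?thesis
    using zero_le_power2[of "norm (u (Suc T) - v)"] by linarith
qed

text \<open>The tangent residual at \<open>u (Suc t)\<close>: the operator value there plus the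
  normal vector \<open>u t - \<Phi> (z (Suc t)) - u (Suc t)\<close> produced by the projection. For
  \<open>t \<ge> 1\<close> the first point that carries one is \<open>u 2\<close>.\<close>

definition res :: "nat \<Rightarrow> 'a" where
  "res t = u t - u (Suc t) + \<Phi> (u (Suc t)) - \<Phi> (z (Suc t))"

lemma res_normal:
  assumes "t \<ge> 1" "v \<in> K"
  shows "(res t - \<Phi> (u (Suc t))) \<bullet> (v - u (Suc t)) \<le> 0"
  using proj_pointD[OF u_proj[OF assms(1)] assms(2)] by (simp add: res_def algebra_simps)

lemma res_antimono:
  assumes "1 \<le> t" "t \<le> T"
  shows "norm (res T) \<le> norm (res t)"
  using assms(2)
proof (induction T rule: dec_induct)
  case (step T)
  have "(norm (\<Phi> (z (Suc (Suc T))) - \<Phi> (u (Suc (Suc T)))))\<^sup>2 \<le> (norm (z (Suc (Suc T)) - u (Suc (Suc T))))\<^sup>2"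
    using lip_correction[of "Suc T"] zero_le_power2[of "norm (z (Suc (Suc T)) - u (Suc (Suc T)))"]
    by linarith
  then have "norm (res (Suc T)) \<le> norm (\<Phi> (u (Suc T)) + (res T - \<Phi> (u (Suc T))))"
    using assms step unfolding res_def[of "Suc T"]
    by (intro eg_step.residual_decreasing[OF step_t _ res_normal]) auto
  then show ?case using step by simp
qed simp

lemma half_step_le_res:
  assumes "1 \<le> t" "t < T"
  shows "norm (u T - z (Suc T)) \<le> norm (res t)"
proof -
  obtain S where S: "T = Suc S" "t \<le> S" using assms by (cases T) auto
  have "norm (u T - z (Suc T)) \<le> norm (\<Phi> (u T) + (res S - \<Phi> (u T)))"
    using eg_step.half_step_le_residual[OF step_t res_normal] assms S by auto
  also have "\<dots> \<le> norm (res t)" using res_antimono assms S by auto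
  finally show ?thesis .
qed

text \<open>The last half step is bounded by all earlier residuals, hence by every gain up to
  \<open>T\<close>; the gains telescope to at most the initial squared distance.\<close>

lemma half_step_rate:
  assumes "T \<ge> 1"
  shows "real T * (norm (u T - z (Suc T)))\<^sup>2 \<le> 13 / 3 * (norm (u 1 - p))\<^sup>2"
proof -
  have "(norm (u T - z (Suc T)))\<^sup>2 \<le> 13 / 3 * ((norm (u t - p))\<^sup>2 - (norm (u (Suc t) - p))\<^sup>2)"
    if t: "t \<in> {1..T}" for t
  proof -
    have g: "0 \<le> gain t" "gain t \<le> (norm (u t - p))\<^sup>2 - (norm (u (Suc t) - p))\<^sup>2"
      using descent_p[OF _ u_near_R] t by auto
    have "(norm (u T - z (Suc T)))\<^sup>2 \<le> 13 / 3 * gain t"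
    \<comment> \<open>\<open>res T\<close> belongs to \<open>u (Suc T)\<close> and comes too late to
      bound the half step from \<open>u T\<close>; for \<open>t = T\<close> the half step is
      compared with the gain directly, with 3 below 13/3.\<close>
    proof (cases "t = T")
      case True
      then show ?thesis
        using eg_step.half_step_sq_le_gain[OF step_t[of t]] t g by auto
    next
      case False
      then have "(norm (u T - z (Suc T)))\<^sup>2 \<le> (norm (res t))\<^sup>2"
        using half_step_le_res t by (intro power_mono) auto
      also have "\<dots> \<le> 13 / 3 * gain t"
        using eg_step.residual_sq_le_gain[OF step_t lip_correction] t by (simp add: res_def)
      finally show ?thesis .
    qed
    also have "\<dots> \<le> 13 / 3 * ((norm (u t - p))\<^sup>2 - (norm (u (Suc t) - p))\<^sup>2)"
      using g(2) by (rule mult_left_mono) simp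
    finally show ?thesis .
  qed
  then have "real T * (norm (u T - z (Suc T)))\<^sup>2
      \<le> (\<Sum>t=1..T. 13 / 3 * ((norm (u t - p))\<^sup>2 - (norm (u (Suc t) - p))\<^sup>2))"
    using sum_bounded_below[of "{1..T}" "(norm (u T - z (Suc T)))\<^sup>2"] by simp
  also have "\<dots> = 13 / 3 * (norm (u 1 - p))\<^sup>2 - 13 / 3 * (norm (u (Suc T) - p))\<^sup>2"
    using assms sum_Suc_diff[of 1 T "\<lambda>t. - (norm (u t - p))\<^sup>2"]
    unfolding sum_distrib_left[symmetric] by (simp add: sum_subtractf)
  finally show ?thesis
    using zero_le_power2[of "norm (u (Suc T) - p)"] by linarith
qed

lemma last_iterate_gap:
  assumes "T \<ge> 1" "v \<in> K"
  shows "\<Phi> (z (Suc T)) \<bullet> (z (Suc T) - v) \<le> sqrt (65 / 9) * norm (u 1 - p) / sqrt T * norm (z (Suc T) - v)"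
proof -
  have "(norm (u T - z (Suc T)))\<^sup>2 \<le> 13 / 3 * ((norm (u 1 - p))\<^sup>2 / real T)"
    using half_step_rate[OF assms(1)] assms(1) by (simp add: field_simps)
  then have "norm (u T - z (Suc T)) \<le> sqrt (13 / 3) * (norm (u 1 - p) / sqrt T)"
    by (intro sqrt_bound_mult_le) (simp_all add: power_divide)
  then have "sqrt (5 / 3) * norm (u T - z (Suc T)) \<le> sqrt (5 / 3) * (sqrt (13 / 3) * (norm (u 1 - p) / sqrt T))"
    by (rule mult_left_mono) simp
  also have "\<dots> = sqrt (65 / 9) * norm (u 1 - p) / sqrt T"
    using real_sqrt_mult[of "5 / 3" "13 / 3"] by simp
  finally have "sqrt (5 / 3) * norm (u T - z (Suc T)) * norm (z (Suc T) - v)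
      \<le> sqrt (65 / 9) * norm (u 1 - p) / sqrt T * norm (z (Suc T) - v)"
    by (rule mult_right_mono) simp
  then show ?thesis
    using eg_step.gap_le_half_step[OF step_t[OF assms(1)] assms(2)] by (rule order_trans[rotated])
qed

end

section \<open>Spectral theorem and ordered eigenvalues\<close>

lemma sym_mats_inner:
  assumes "X \<in> sym_mats"
  shows "x \<bullet> (X *v y) = (X *v x) \<bullet> y"
proof -
  have "transpose X = X" using assms by (simp add: sym_mats_def)
  then show ?thesis by (metis dot_lmul_matrix vector_transpose_matrix)
qed

lemma inner_outer: "X \<bullet> outer v = v \<bullet> (X *v v)"
  by (simp add: inner_vec_def outer_def matrix_vector_mult_def sum_distrib_left mult_ac)

lemma outer_inner_outer: "outer v \<bullet> outer w = (v \<bullet> w)\<^sup>2"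
  by (simp add: inner_vec_def outer_def power2_eq_square sum_product mult_ac)

lemma outer_mult_vec: "outer v *v x = (v \<bullet> x) *\<^sub>R v"
  by (simp add: vec_eq_iff outer_def matrix_vector_mult_def inner_vec_def sum_distrib_left mult_ac)

lemma outer_in_sym_mats: "outer v \<in> sym_mats"
  by (simp add: sym_mats_def outer_def transpose_def vec_eq_iff mult.commute)

lemma outer_in_psd_mats: "outer v \<in> psd_mats"
  by (simp add: psd_mats_def outer_in_sym_mats outer_mult_vec inner_commute)

lemma psd_mats_eq: "psd_mats = sym_mats \<inter> (\<Inter>x. {X. outer x \<bullet> X \<ge> 0})"
  by (auto simp: psd_mats_def inner_outer[symmetric] inner_commute)

lemma closed_psd_mats: "closed psd_mats"
  unfolding psd_mats_eq
  by (intro closed_Int closed_INT ballI closed_halfspace_ge closed_subspace subspace_sym_mats)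

lemma convex_psd_mats: "convex psd_mats"
  unfolding psd_mats_eq
  by (intro convex_Int convex_INT convex_halfspace_ge subspace_imp_convex subspace_sym_mats)

lemma psd_mats_add: "X \<in> psd_mats \<Longrightarrow> Y \<in> psd_mats \<Longrightarrow> X + Y \<in> psd_mats"
  by (simp add: psd_mats_eq inner_add_right subspace_add subspace_sym_mats)

lemma psd_mats_scale: "X \<in> psd_mats \<Longrightarrow> 0 \<le> c \<Longrightarrow> c *\<^sub>R X \<in> psd_mats"
  by (simp add: psd_mats_eq subspace_scale subspace_sym_mats)

lemma psd_mats_zero: "0 \<in> psd_mats"
  by (simp add: psd_mats_eq subspace_0 subspace_sym_mats)

lemma psd_mats_sum: "(\<And>i. i \<in> I \<Longrightarrow> h i \<in> psd_mats) \<Longrightarrow> sum h I \<in> psd_mats"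
  by (induction I rule: infinite_finite_induct) (auto intro: psd_mats_add psd_mats_zero)

lemma psd_mats_sym: "X \<in> psd_mats \<Longrightarrow> X \<in> sym_mats"
  by (simp add: psd_mats_eq)

lemma psd_mats_quad: "X \<in> psd_mats \<Longrightarrow> 0 \<le> x \<bullet> (X *v x)"
  by (simp add: psd_mats_def)

section \<open>Sorted orthonormal eigenbases\<close>

definition orthonormal :: "(nat \<Rightarrow> real^'n) \<Rightarrow> bool" where
  "orthonormal v \<longleftrightarrow> (\<forall>i\<in>{1..CARD('n)}. \<forall>j\<in>{1..CARD('n)}. v i \<bullet> v j = (if i = j then 1 else 0))"

text \<open>A maximiser \<open>v\<close> of the Rayleigh quotient on the unit sphere of
  \<open>S\<close> is an eigenvector: otherwise moving along \<open>h\<close>, the part of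
  \<open>X *v v\<close> orthogonal to \<open>v\<close>, would increase the quotient to first
  order.\<close>

lemma exists_eigenvector_in_invariant_subspace:
  fixes X :: "real^'n^'n"
  assumes X: "X \<in> sym_mats" and S: "subspace S" "\<And>x. x \<in> S \<Longrightarrow> X *v x \<in> S" "S \<noteq> {0}"
  obtains v c where "v \<in> S" "norm v = 1" "X *v v = c *\<^sub>R v"
proof -
  obtain a where a: "a \<in> S" "a \<noteq> 0" using S subspace_0 by blast
  have "compact (S \<inter> sphere 0 1)"
    by (simp add: closed_Int_compact closed_subspace S)
  moreover have "(1 / norm a) *\<^sub>R a \<in> S \<inter> sphere 0 1"
    using a S by (simp add: subspace_scale)
  moreover have "continuous_on (S \<inter> sphere 0 1) (\<lambda>x. x \<bullet> (X *v x))"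
    by (intro continuous_intros)
  ultimately obtain v where v: "v \<in> S" "norm v = 1"
    and max: "\<And>x. x \<in> S \<Longrightarrow> norm x = 1 \<Longrightarrow> x \<bullet> (X *v x) \<le> v \<bullet> (X *v v)"
    using continuous_attains_sup[of "S \<inter> sphere 0 1" "\<lambda>x. x \<bullet> (X *v x)"]
    by (metis Int_iff empty_iff mem_sphere_0)
  define c where "c = v \<bullet> (X *v v)"
  have q: "0 \<le> c * (x \<bullet> x) - x \<bullet> (X *v x)" if "x \<in> S" for x
  proof (cases "x = 0")
    case False
    have "((1 / norm x) *\<^sub>R x) \<bullet> (X *v ((1 / norm x) *\<^sub>R x)) \<le> c"
      unfolding c_def using that False S by (intro max subspace_scale) auto
    then have "(x \<bullet> (X *v x)) / (x \<bullet> x) \<le> c"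
      by (simp add: matrix_vector_mult_scaleR power2_norm_eq_inner[symmetric] power2_eq_square)
    then show ?thesis using False by (simp add: divide_simps)
  qed simp
  define h where "h = X *v v - c *\<^sub>R v"
  have h: "h \<in> S" unfolding h_def using v S by (intro subspace_diff subspace_scale) auto
  have vv: "v \<bullet> v = 1" using v by (simp add: norm_eq_1)
  have hv: "v \<bullet> h = 0" by (simp add: h_def inner_diff_right c_def vv)
  have Xv: "X *v v = h + c *\<^sub>R v" by (simp add: h_def)
  have vh: "v \<bullet> (X *v h) = h \<bullet> h"
    unfolding sym_mats_inner[OF X] Xv using hv by (simp add: inner_add_left)
  have hXv: "h \<bullet> (X *v v) = h \<bullet> h"
    unfolding Xv using hv by (simp add: inner_add_right inner_commute)
  have "h \<bullet> h \<le> 0"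
  proof (rule ccontr)
    assume "\<not> h \<bullet> h \<le> 0"
    define q' where "q' = c * (h \<bullet> h) - h \<bullet> (X *v h)"
    \<comment> \<open>Small enough for the linear term \<open>2 * (h \<bullet> h)\<close> to beat
      \<open>t * q'\<close>; the summand 1 keeps the denominator positive when
      \<open>q' = 0\<close>.\<close>
    define t where "t = (h \<bullet> h) / (q' + 1)"
    have q': "0 \<le> q'" using q[OF h] by (simp add: q'_def)
    have "0 \<le> c * ((v + t *\<^sub>R h) \<bullet> (v + t *\<^sub>R h)) - (v + t *\<^sub>R h) \<bullet> (X *v (v + t *\<^sub>R h))"
      using v h S by (intro q subspace_add subspace_scale) auto
    also have "\<dots> = t * (t * q' - 2 * (h \<bullet> h))"
      using hv vv vh hXv
      by (simp add: q'_def inner_simps inner_commute matrix_vector_right_distrib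
          matrix_vector_mult_scaleR c_def[symmetric] algebra_simps)
    finally have "2 * (h \<bullet> h) \<le> t * q'"
      using \<open>\<not> h \<bullet> h \<le> 0\<close> q' by (simp add: t_def zero_le_mult_iff divide_simps)
    also have "t * q' \<le> h \<bullet> h"
      using \<open>\<not> h \<bullet> h \<le> 0\<close> q' by (simp add: t_def divide_simps distrib_left)
    finally show False using \<open>\<not> h \<bullet> h \<le> 0\<close> by linarith
  qed
  then have "h = 0" by (metis inner_gt_zero_iff linorder_not_less)
  then show ?thesis using v that by (simp add: h_def)
qed

text \<open>Splitting off one eigenvector leaves its orthogonal complement in \<open>S\<close>,
  which is invariant by symmetry and of smaller dimension.\<close>

lemma exists_eigenbasis_of_invariant_subspace:
  fixes X :: "real^'n^'n"
  assumes X: "X \<in> sym_mats"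
  shows "subspace S \<Longrightarrow> (\<And>x. x \<in> S \<Longrightarrow> X *v x \<in> S) \<Longrightarrow>
    \<exists>B. B \<subseteq> S \<and> S \<subseteq> span B \<and> pairwise orthogonal B \<and> (\<forall>v\<in>B. norm v = 1 \<and> (\<exists>c. X *v v = c *\<^sub>R v))"
proof (induction "dim S" arbitrary: S rule: less_induct)
  case less
  show ?case
  proof (cases "S = {0}")
    case True
    then show ?thesis by (intro exI[of _ "{}"]) auto
  next
    case False
    then obtain v c where v: "v \<in> S" "norm v = 1" "X *v v = c *\<^sub>R v"
      using exists_eigenvector_in_invariant_subspace[OF X] less.prems by metis
    define S' where "S' = S \<inter> {x. v \<bullet> x = 0}"
    have S': "subspace S'"
      unfolding S'_def using less.prems(1) subspace_hyperplane by (rule subspace_inter)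
    have "v \<notin> S'" using v by (simp add: S'_def norm_eq_1)
    moreover have "S' \<subseteq> S" by (simp add: S'_def)
    ultimately have "S' \<subset> S" using v(1) by blast
    then have "dim S' < dim S"
      using S' less.prems(1) by (metis dim_psubset span_eq_iff)
    moreover have "X *v x \<in> S'" if "x \<in> S'" for x
      using that less.prems(2) v by (auto simp: S'_def sym_mats_inner[OF X])
    ultimately obtain B where B: "B \<subseteq> S'" "S' \<subseteq> span B" "pairwise orthogonal B"
      "\<forall>v\<in>B. norm v = 1 \<and> (\<exists>c. X *v v = c *\<^sub>R v)"
      using less.hyps[of S'] S' by metis
    have "S \<subseteq> span (insert v B)"
    proof
      fix x assume "x \<in> S"
      then have "x - (v \<bullet> x) *\<^sub>R v \<in> S'"
        using v less.prems(1) by (auto simp: S'_def subspace_diff subspace_scale inner_diff_right norm_eq_1)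
      then have "x - (v \<bullet> x) *\<^sub>R v \<in> span B" using B by auto
      then show "x \<in> span (insert v B)" by (auto simp: span_insert)
    qed
    moreover have "pairwise orthogonal (insert v B)"
      using B(1,3) by (auto simp: pairwise_insert S'_def orthogonal_def inner_commute)
    moreover have "insert v B \<subseteq> S" using v B by (auto simp: S'_def)
    ultimately show ?thesis using v B(4) by blast
  qed
qed

lemma exists_sorted_eigenbasis:
  fixes X :: "real^'n^'n"
  assumes X: "X \<in> sym_mats"
  obtains v d where "orthonormal v" "\<And>i. i \<in> {1..CARD('n)} \<Longrightarrow> X *v v i = d i *\<^sub>R v i"
    "\<And>i j. 1 \<le> i \<Longrightarrow> i \<le> j \<Longrightarrow> j \<le> CARD('n) \<Longrightarrow> d j \<le> d i"
proof -
  obtain B where B: "UNIV \<subseteq> span B" "pairwise orthogonal B"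
    and eig: "\<And>v. v \<in> B \<Longrightarrow> norm v = 1 \<and> (\<exists>c. X *v v = c *\<^sub>R v)"
    using exists_eigenbasis_of_invariant_subspace[OF X subspace_UNIV] by auto
  have ind: "independent B"
    using B eig by (intro pairwise_orthogonal_independent) (auto dest: eig)
  then have fin: "finite B" by (rule independent_imp_finite)
  have card: "card B = CARD('n)"
    using ind B dim_eq_card[of B UNIV] by (simp add: top.extremum_unique)
  \<comment> \<open>For a unit eigenvector the quadratic form is its eigenvalue; the minus sign
    turns the ascending sort into a descending one.\<close>
  define xs where "xs = sort_key (\<lambda>v. - (v \<bullet> (X *v v))) (SOME xs. set xs = B \<and> distinct xs)"
  have "set (SOME xs. set xs = B \<and> distinct xs) = B \<and> distinct (SOME xs. set xs = B \<and> distinct xs)"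
    using finite_distinct_list[OF fin] by (rule someI_ex)
  then have xs: "set xs = B" "distinct xs" "sorted (map (\<lambda>v. - (v \<bullet> (X *v v))) xs)"
    by (auto simp: xs_def)
  have len: "length xs = CARD('n)" using xs card distinct_card by metis
  define v where "v = (\<lambda>i. xs ! (i - 1))"
  have vB: "v i \<in> B" if "i \<in> {1..CARD('n)}" for i
    using that len xs by (auto simp: v_def)
  show ?thesis
  proof
    show "orthonormal v"
      unfolding orthonormal_def
    proof (intro ballI)
      fix i j assume ij: "i \<in> {1..CARD('n)}" "j \<in> {1..CARD('n)}"
      show "v i \<bullet> v j = (if i = j then 1 else 0)"
      proof (cases "i = j")
        case True
        then show ?thesis using eig[OF vB[OF ij(1)]] by (simp add: norm_eq_1)
      next
        case False
        then have "v i \<noteq> v j" using ij len xs by (auto simp: v_def nth_eq_iff_index_eq)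
        then show ?thesis using False B(2) vB ij by (auto simp: pairwise_def orthogonal_def)
      qed
    qed
    show "X *v v i = (v i \<bullet> (X *v v i)) *\<^sub>R v i" if "i \<in> {1..CARD('n)}" for i
      using eig[OF vB[OF that]] by (auto simp: norm_eq_1)
    show "v j \<bullet> (X *v v j) \<le> v i \<bullet> (X *v v i)" if "1 \<le> i" "i \<le> j" "j \<le> CARD('n)" for i j
      using sorted_nth_mono[OF xs(3), of "i - 1" "j - 1"] that len by (simp add: v_def)
  qed
qed

lemma sum_mult_vec: "(\<Sum>i\<in>I. h i) *v x = (\<Sum>i\<in>I. h i *v x)" for h :: "'b \<Rightarrow> real^'n^'m"
  by (induction I rule: infinite_finite_induct) (auto simp: matrix_vector_mult_add_rdistrib)

context
  fixes v :: "nat \<Rightarrow> real^'n"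
  assumes v: "orthonormal v"
begin

lemma orthonormal_inner: "i \<in> {1..CARD('n)} \<Longrightarrow> j \<in> {1..CARD('n)} \<Longrightarrow> v i \<bullet> v j = (if i = j then 1 else 0)"
  using v by (simp add: orthonormal_def)

lemma orthonormal_norm: "i \<in> {1..CARD('n)} \<Longrightarrow> norm (v i) = 1"
  using orthonormal_inner by (simp add: norm_eq_1)

lemma orthonormal_inj_on: "inj_on v {1..CARD('n)}"
proof (rule inj_onI)
  fix i j assume ij: "i \<in> {1..CARD('n)}" "j \<in> {1..CARD('n)}" "v i = v j"
  then show "i = j" using orthonormal_inner[of i j] orthonormal_inner[of i i] by (auto split: if_splits)
qed

lemma orthonormal_pairwise:
  assumes "I \<subseteq> {1..CARD('n)}"
  shows "pairwise orthogonal (v ` I)"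
  unfolding pairwise_def orthogonal_def
proof clarify
  fix i j assume "i \<in> I" "j \<in> I" "v i \<noteq> v j"
  moreover from this have "i \<in> {1..CARD('n)}" "j \<in> {1..CARD('n)}" using assms by auto
  ultimately show "v i \<bullet> v j = 0" using orthonormal_inner[of i j] by auto
qed

lemma orthonormal_independent: "I \<subseteq> {1..CARD('n)} \<Longrightarrow> independent (v ` I)"
  using orthonormal_norm by (intro pairwise_orthogonal_independent orthonormal_pairwise) fastforce+

lemma orthonormal_dim_span:
  assumes "I \<subseteq> {1..CARD('n)}"
  shows "dim (span (v ` I)) = card I"
  using dim_span_eq_card_independent[OF orthonormal_independent[OF assms]]
    card_image[OF inj_on_subset[OF orthonormal_inj_on assms]] by simp

lemma orthonormal_expand: "(\<Sum>i=1..CARD('n). (v i \<bullet> x) *\<^sub>R v i) = x"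
proof -
  have "span (v ` {1..CARD('n)}) = UNIV"
    using orthonormal_dim_span[of "{1..CARD('n)}"] by (simp add: dim_eq_full[symmetric])
  then have "(\<Sum>b\<in>v ` {1..CARD('n)}. (x \<bullet> b) *\<^sub>R b) = x"
    by (intro orthonormal_basis_expand orthonormal_pairwise) (auto simp: orthonormal_norm)
  then show ?thesis
    unfolding sum.reindex[OF orthonormal_inj_on] o_def inner_commute[of x] .
qed

lemma orthonormal_norm_sq: "x \<bullet> x = (\<Sum>i=1..CARD('n). (v i \<bullet> x)\<^sup>2)"
proof -
  have "x \<bullet> x = (\<Sum>i=1..CARD('n). (v i \<bullet> x) *\<^sub>R v i) \<bullet> x" by (simp only: orthonormal_expand)
  then show ?thesis by (simp add: inner_sum_left power2_eq_square)
qed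

lemma orthonormal_eq_sum_outer:
  assumes "\<And>i. i \<in> {1..CARD('n)} \<Longrightarrow> X *v v i = d i *\<^sub>R v i"
  shows "X = (\<Sum>i=1..CARD('n). d i *\<^sub>R outer (v i))"
proof -
  have "X *v x = (\<Sum>i=1..CARD('n). d i *\<^sub>R outer (v i)) *v x" for x
  proof -
    have "X *v x = X *v (\<Sum>i=1..CARD('n). (v i \<bullet> x) *\<^sub>R v i)" by (simp only: orthonormal_expand)
    also have "\<dots> = (\<Sum>i=1..CARD('n). (v i \<bullet> x) *\<^sub>R (X *v v i))"
      by (simp add: linear_sum linear_scale matrix_vector_mult_scaleR)
    also have "\<dots> = (\<Sum>i=1..CARD('n). d i *\<^sub>R ((v i \<bullet> x) *\<^sub>R v i))"
      using assms by (intro sum.cong) auto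
    finally show ?thesis
      by (simp add: sum_mult_vec outer_mult_vec scaleR_matrix_vector_assoc[symmetric])
  qed
  then show ?thesis by (simp add: matrix_eq)
qed

end

section \<open>Characteristic polynomial and ordered eigenvalues\<close>

lemma poly_charpoly: "poly (charpoly X) t = det (t *\<^sub>R mat 1 - X)"
  unfolding charpoly_def det_def
  by (auto simp: poly_sum poly_prod mat_def intro!: sum.cong prod.cong)

text \<open>Diagonalising with the matrix \<open>Q\<close> of eigenvectors gives the determinant at
  every \<open>t\<close>, and a real polynomial is determined by its values. The bijection
  \<open>\<sigma>\<close> carries the numbering by naturals over to the index type.\<close>

lemma charpoly_eq_prod:
  fixes X :: "real^'n^'n"
  assumes v: "orthonormal v" and d: "\<And>i. i \<in> {1..CARD('n)} \<Longrightarrow> X *v v i = d i *\<^sub>R v i"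
  shows "charpoly X = (\<Prod>i=1..CARD('n). [:- d i, 1:])"
proof -
  obtain \<sigma> where \<sigma>: "bij_betw \<sigma> (UNIV :: 'n set) {1..CARD('n)}"
    using finite_same_card_bij[of "UNIV :: 'n set" "{1..CARD('n)}"] by auto
  then have \<sigma>m: "\<sigma> k \<in> {1..CARD('n)}" for k by (auto simp: bij_betw_def)
  have \<sigma>i: "\<sigma> k = \<sigma> j \<longleftrightarrow> k = j" for k j using \<sigma> by (auto simp: bij_betw_def inj_eq)
  define Q :: "real^'n^'n" where "Q = (\<chi> i k. v (\<sigma> k) $ i)"
  have col: "column k Q = v (\<sigma> k)" for k by (simp add: Q_def column_def vec_eq_iff)
  have "orthogonal_matrix Q"
    unfolding orthogonal_matrix_orthonormal_columns col
    using orthonormal_norm[OF v \<sigma>m] orthonormal_inner[OF v \<sigma>m \<sigma>m] \<sigma>i by (simp add: orthogonal_def)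
  then have Q: "det Q \<noteq> 0" using det_orthogonal_matrix by fastforce
  have "det (t *\<^sub>R mat 1 - X) = (\<Prod>i=1..CARD('n). t - d i)" for t
  proof -
    define E :: "real^'n^'n" where "E = (\<chi> i j. if i = j then t - d (\<sigma> i) else 0)"
    have "(t *\<^sub>R mat 1 - X) ** Q = Q ** E"
    proof (rule iffD2[OF vec_eq_iff], intro allI, rule iffD2[OF vec_eq_iff], intro allI)
      fix i k
      have "((t *\<^sub>R mat 1 - X) ** Q) $ i $ k = ((t *\<^sub>R mat 1 - X) *v v (\<sigma> k)) $ i"
        by (simp add: matrix_matrix_mult_def matrix_vector_mult_def Q_def)
      also have "\<dots> = (t - d (\<sigma> k)) * v (\<sigma> k) $ i"
        using d[OF \<sigma>m]
        by (simp add: matrix_vector_mult_diff_rdistrib scaleR_matrix_vector_assoc[symmetric] left_diff_distrib)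
      also have "\<dots> = (Q ** E) $ i $ k"
        by (simp add: matrix_matrix_mult_def Q_def E_def if_distrib cong: if_cong)
      finally show "((t *\<^sub>R mat 1 - X) ** Q) $ i $ k = (Q ** E) $ i $ k" .
    qed
    then have "det (t *\<^sub>R mat 1 - X) * det Q = det Q * det E" by (metis det_mul)
    then have "det (t *\<^sub>R mat 1 - X) = det E" using Q by simp
    also have "\<dots> = (\<Prod>i\<in>UNIV. t - d (\<sigma> i))"
      by (subst det_diagonal) (auto simp: E_def)
    also have "\<dots> = (\<Prod>i=1..CARD('n). t - d i)"
      by (rule prod.reindex_bij_betw[OF \<sigma>])
    finally show ?thesis .
  qed
  then have "poly (charpoly X) = poly (\<Prod>i=1..CARD('n). [:- d i, 1:])"
    by (auto simp: poly_charpoly poly_prod)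
  then show ?thesis by (simp add: poly_eq_poly_eq_iff)
qed

text \<open>The one place where the definition through roots of the characteristic polynomial is
  unfolded; from here on eigenvalues are handled through eigenbases.\<close>

lemma eigval_eqI:
  fixes X :: "real^'n^'n"
  assumes v: "orthonormal v" and d: "\<And>i. i \<in> {1..CARD('n)} \<Longrightarrow> X *v v i = d i *\<^sub>R v i"
    and anti: "\<And>i j. 1 \<le> i \<Longrightarrow> i \<le> j \<Longrightarrow> j \<le> CARD('n) \<Longrightarrow> d j \<le> d i"
    and i: "i \<in> {1..CARD('n)}"
  shows "eigval X i = d i"
proof -
  let ?xs = "map d [1..<Suc CARD('n)]"
  have cp: "charpoly X = (\<Prod>i=1..CARD('n). [:- d i, 1:])"
    using v d by (rule charpoly_eq_prod)
  have "proots (charpoly X) = (\<Sum>i=1..CARD('n). {#d i#})"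
    unfolding cp by (subst proots_prod) auto
  also have "\<dots> = image_mset d (mset_set {1..CARD('n)})"
  proof -
    have "(\<Sum>i\<in>I. {#d i#}) = image_mset d (mset_set I)" if "finite I" for I
      using that by induction auto
    then show ?thesis by simp
  qed
  also have "\<dots> = mset ?xs"
    by (simp del: upt_Suc add: atLeastLessThanSuc_atLeastAtMost)
  finally have p: "proots (charpoly X) = mset ?xs" .
  have "sort ?xs = rev ?xs"
  proof (rule properties_for_sort)
    show "sorted (rev ?xs)"
      unfolding sorted_wrt_rev sorted_wrt_map
      by (rule sorted_wrt_mono_rel[OF _ sorted_wrt_upt]) (auto intro: anti)
  qed simp
  then have "rev (sorted_list_of_multiset (proots (charpoly X))) = ?xs"
    unfolding p sorted_list_of_multiset_mset by (simp del: upt_Suc)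
  moreover have "?xs ! (i - 1) = d i"
  proof -
    obtain j where "i = Suc j" "j < CARD('n)" using i by (cases i) auto
    then show ?thesis by (subst nth_map) (simp_all add: nth_upt del: upt_Suc)
  qed
  ultimately show ?thesis by (simp only: eigval_def)
qed

lemma exists_eigen_decomposition:
  fixes X :: "real^'n^'n"
  assumes "X \<in> sym_mats"
  obtains v where "eigen_decomposition X v"
proof -
  obtain v d where v: "orthonormal v" and d: "\<And>i. i \<in> {1..CARD('n)} \<Longrightarrow> X *v v i = d i *\<^sub>R v i"
    and anti: "\<And>i j. 1 \<le> i \<Longrightarrow> i \<le> j \<Longrightarrow> j \<le> CARD('n) \<Longrightarrow> d j \<le> d i"
    using exists_sorted_eigenbasis[OF assms] by metis
  have "X = (\<Sum>i=1..CARD('n). eigval X i *\<^sub>R outer (v i))"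
    using d eigval_eqI[of v X d, OF v d anti] by (intro orthonormal_eq_sum_outer[OF v]) simp
  then show ?thesis
    using that v by (simp add: eigen_decomposition_def orthonormal_def)
qed

lemma eigval_antimono:
  fixes X :: "real^'n^'n"
  assumes "X \<in> sym_mats" "1 \<le> i" "i \<le> j" "j \<le> CARD('n)"
  shows "eigval X j \<le> eigval X i"
proof -
  obtain v d where v: "orthonormal v" and d: "\<And>i. i \<in> {1..CARD('n)} \<Longrightarrow> X *v v i = d i *\<^sub>R v i"
    and anti: "\<And>i j. 1 \<le> i \<Longrightarrow> i \<le> j \<Longrightarrow> j \<le> CARD('n) \<Longrightarrow> d j \<le> d i"
    using exists_sorted_eigenbasis[OF assms(1)] by metis
  show ?thesis
    using eigval_eqI[of v X d, OF v d anti] anti assms by auto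
qed

section \<open>Projections and eigenvalue perturbation\<close>

context
  fixes M :: "real^'n^'n" and v :: "nat \<Rightarrow> real^'n"
  assumes dec: "eigen_decomposition M v"
begin

lemma eigen_decomposition_orthonormal: "orthonormal v"
  using dec by (simp add: eigen_decomposition_def orthonormal_def)

lemma eigen_decomposition_eq: "M = (\<Sum>i=1..CARD('n). eigval M i *\<^sub>R outer (v i))"
  using dec by (simp add: eigen_decomposition_def)

lemma eigen_decomposition_sym: "M \<in> sym_mats"
  by (subst eigen_decomposition_eq)
     (intro subspace_sum subspace_scale subspace_sym_mats outer_in_sym_mats)

lemma eigen_decomposition_quad: "x \<bullet> (M *v x) = (\<Sum>i=1..CARD('n). eigval M i * (v i \<bullet> x)\<^sup>2)"
proof -
  have "x \<bullet> (M *v x) = (\<Sum>i=1..CARD('n). eigval M i *\<^sub>R outer (v i)) \<bullet> outer x"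
    by (simp only: inner_outer flip: eigen_decomposition_eq)
  then show ?thesis by (simp add: inner_sum_left outer_inner_outer)
qed

lemma eigen_decomposition_mult_vec:
  "M *v x = (\<Sum>i=1..CARD('n). (eigval M i * (v i \<bullet> x)) *\<^sub>R v i)"
proof -
  have "M *v x = (\<Sum>i=1..CARD('n). eigval M i *\<^sub>R outer (v i)) *v x"
    by (simp only: flip: eigen_decomposition_eq)
  then show ?thesis
    by (simp add: sum_mult_vec scaleR_matrix_vector_assoc[symmetric] outer_mult_vec)
qed

lemma eigen_decomposition_eigenvector:
  assumes "i \<in> {1..CARD('n)}"
  shows "M *v v i = eigval M i *\<^sub>R v i"
proof -
  have "(\<Sum>j=1..CARD('n). (eigval M j * (v j \<bullet> v i)) *\<^sub>R v j)
      = (\<Sum>j=1..CARD('n). if j = i then eigval M i *\<^sub>R v i else 0)"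
    using orthonormal_inner[OF eigen_decomposition_orthonormal _ assms] by (intro sum.cong) auto
  then show ?thesis
    unfolding eigen_decomposition_mult_vec using assms by simp
qed

lemma eigen_decomposition_eigval: "i \<in> {1..CARD('n)} \<Longrightarrow> eigval M i = v i \<bullet> (M *v v i)"
  using orthonormal_inner[OF eigen_decomposition_orthonormal]
  by (simp add: eigen_decomposition_eigenvector)

text \<open>Moreau decomposition: the negative part of \<open>M\<close> is orthogonal to the
  positive part and has nonpositive inner product with every positive semidefinite matrix, which is
  the variational inequality of the projection.\<close>

lemma psd_proj_eq: "is_psd_proj M P \<longleftrightarrow> P = (\<Sum>i=1..CARD('n). max (eigval M i) 0 *\<^sub>R outer (v i))"
proof -
  let ?P = "\<Sum>i=1..CARD('n). max (eigval M i) 0 *\<^sub>R outer (v i)"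
  have P: "?P \<in> psd_mats"
    by (intro psd_mats_sum psd_mats_scale outer_in_psd_mats) simp
  have diff: "M - ?P = (\<Sum>i=1..CARD('n). min (eigval M i) 0 *\<^sub>R outer (v i))"
  proof -
    have "M - ?P = (\<Sum>i=1..CARD('n). eigval M i *\<^sub>R outer (v i)) - ?P"
      by (simp only: flip: eigen_decomposition_eq)
    also have "\<dots> = (\<Sum>i=1..CARD('n). (eigval M i - max (eigval M i) 0) *\<^sub>R outer (v i))"
      by (simp add: sum_subtractf scaleR_left_diff_distrib)
    also have "\<dots> = (\<Sum>i=1..CARD('n). min (eigval M i) 0 *\<^sub>R outer (v i))"
      by (intro sum.cong refl arg_cong2[where f = "(*\<^sub>R)"]) auto
    finally show ?thesis .
  qed
  have "proj_point psd_mats M ?P"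
    unfolding proj_point_def
  proof (intro conjI ballI P)
    fix Y :: "real^'n^'n" assume Y: "Y \<in> psd_mats"
    have "(M - ?P) \<bullet> Y = (\<Sum>i=1..CARD('n). min (eigval M i) 0 * (v i \<bullet> (Y *v v i)))"
      unfolding diff inner_commute[of _ Y] by (simp add: inner_sum_right inner_outer)
    also have "\<dots> \<le> 0"
      by (intro sum_nonpos mult_nonpos_nonneg psd_mats_quad[OF Y]) simp
    finally have 1: "(M - ?P) \<bullet> Y \<le> 0" .
    have "(M - ?P) \<bullet> ?P = (\<Sum>i=1..CARD('n). \<Sum>j=1..CARD('n).
        min (eigval M j) 0 * (max (eigval M i) 0 * (v j \<bullet> v i)\<^sup>2))"
      unfolding diff by (simp add: inner_sum_left inner_sum_right outer_inner_outer sum_distrib_left mult_ac)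
    also have "\<dots> = 0"
      using orthonormal_inner[OF eigen_decomposition_orthonormal]
      by (intro sum.neutral ballI) (auto simp: min_def max_def)
    finally have 2: "(M - ?P) \<bullet> ?P = 0" .
    show "(M - ?P) \<bullet> (Y - ?P) \<le> 0"
      unfolding inner_diff_right 2 using 1 by simp
  qed
  moreover have "proj_point psd_mats M (closest_point psd_mats M)"
    using closed_psd_mats convex_psd_mats psd_mats_zero by (intro proj_point_closest_point) auto
  ultimately have "closest_point psd_mats M = ?P"
    by (rule proj_point_unique[rotated])
  then show ?thesis by (simp add: is_psd_proj_def)
qed

end

text \<open>Each dropped eigenvalue is at most \<open>eigval M (r + 1)\<close>, so its positive part
  vanishes whichever eigenvectors are chosen; the truncated relation is then single-valued.\<close>

lemma trunc_proj_iff_psd_proj: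
  fixes M :: "real^'n^'n"
  assumes M: "M \<in> sym_mats" and r: "r < CARD('n)" and neg: "eigval M (r + 1) \<le> 0"
  shows "is_trunc_proj r M P \<longleftrightarrow> is_psd_proj M P"
proof -
  have eq: "(\<Sum>i=1..r. max (eigval M i) 0 *\<^sub>R outer (v i)) = (\<Sum>i=1..CARD('n). max (eigval M i) 0 *\<^sub>R outer (v i))"
    for v :: "nat \<Rightarrow> real^'n"
  proof (rule sum.mono_neutral_left)
    show "\<forall>i\<in>{1..CARD('n)} - {1..r}. max (eigval M i) 0 *\<^sub>R outer (v i) = 0"
    proof
      fix i assume "i \<in> {1..CARD('n)} - {1..r}"
      then have "eigval M i \<le> eigval M (r + 1)" by (intro eigval_antimono[OF M]) auto
      then show "max (eigval M i) 0 *\<^sub>R outer (v i) = 0" using neg by simp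
    qed
  qed (use r in auto)
  obtain v where "eigen_decomposition M v" using exists_eigen_decomposition[OF M] .
  then show ?thesis
    unfolding is_trunc_proj_def eq using psd_proj_eq by blast
qed

lemma psd_mats_eigval_nonneg:
  fixes M :: "real^'n^'n"
  assumes "M \<in> psd_mats" "i \<in> {1..CARD('n)}"
  shows "0 \<le> eigval M i"
  using exists_eigen_decomposition[OF psd_mats_sym[OF assms(1)]] eigen_decomposition_eigval
    psd_mats_quad[OF assms(1)] assms(2) by metis

lemma psd_mats_quad_eq_0:
  fixes M :: "real^'n^'n"
  assumes M: "M \<in> psd_mats" and x: "x \<bullet> (M *v x) = 0"
  shows "M *v x = 0"
proof -
  obtain v where v: "eigen_decomposition M v"
    using exists_eigen_decomposition[OF psd_mats_sym[OF M]] .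
  have "eigval M i * (v i \<bullet> x)\<^sup>2 = 0" if "i \<in> {1..CARD('n)}" for i
    using x that psd_mats_eigval_nonneg[OF M]
    unfolding eigen_decomposition_quad[OF v] by (subst (asm) sum_nonneg_eq_0_iff) auto
  then show ?thesis
    unfolding eigen_decomposition_mult_vec[OF v] by (intro sum.neutral) auto
qed

text \<open>If the \<open>i\<close>-th eigenvalue vanished, so would all later ones, and the range
  would lie in the span of \<open>i - 1\<close> eigenvectors.\<close>

lemma eigval_pos_of_rank:
  fixes M :: "real^'n^'n"
  assumes M: "M \<in> psd_mats" and i: "1 \<le> i" "i \<le> rank M"
  shows "0 < eigval M i"
proof (rule ccontr)
  assume neg: "\<not> 0 < eigval M i"
  have n: "rank M \<le> CARD('n)" using rank_bound[of M] by simp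
  obtain v where v: "eigen_decomposition M v"
    using exists_eigen_decomposition[OF psd_mats_sym[OF M]] .
  have zero: "eigval M j = 0" if "j \<in> {i..CARD('n)}" for j
    using eigval_antimono[OF psd_mats_sym[OF M], of i j] psd_mats_eigval_nonneg[OF M, of j] neg i that
    by auto
  have "range ((*v) M) \<subseteq> span (v ` {1..i - 1})"
  proof clarify
    fix x
    have "(eigval M j * (v j \<bullet> x)) *\<^sub>R v j \<in> span (v ` {1..i - 1})" if "j \<in> {1..CARD('n)}" for j
    proof (cases "j < i")
      case True
      then show ?thesis using that by (intro span_scale span_base) auto
    next
      case False
      then show ?thesis using zero[of j] that by (simp add: span_zero)
    qed
    then show "M *v x \<in> span (v ` {1..i - 1})"
      unfolding eigen_decomposition_mult_vec[OF v] by (intro span_sum) auto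
  qed
  then have "rank M \<le> dim (span (v ` {1..i - 1}))"
    unfolding rank_dim_range by (rule dim_subset)
  also have "\<dots> = i - 1"
  proof -
    have "{1..i - 1} \<subseteq> {1..CARD('n)}" using i n by auto
    from orthonormal_dim_span[OF eigen_decomposition_orthonormal[OF v] this] show ?thesis by simp
  qed
  finally show False using i by simp
qed

lemma orthonormal_span_inner_eq_0:
  fixes v :: "nat \<Rightarrow> real^'n"
  assumes v: "orthonormal v" and k: "k \<le> CARD('n)" and x: "x \<in> span (v ` {1..k})"
    and i: "i \<in> {1..CARD('n)}" "k < i"
  shows "v i \<bullet> x = 0"
proof -
  have "orthogonal (v i) y" if "y \<in> v ` {1..k}" for y
    using that orthonormal_inner[OF v i(1)] i k by (auto simp: orthogonal_def)
  from orthogonal_to_span[OF x this] show ?thesis by (simp add: orthogonal_def)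
qed

text \<open>The easy half of the min-max principle: \<open>x\<close> has no component along
  eigenvectors beyond the \<open>k\<close>-th.\<close>

lemma quad_ge_eigval:
  fixes M :: "real^'n^'n"
  assumes v: "eigen_decomposition M v" and k: "1 \<le> k" "k \<le> CARD('n)" and x: "x \<in> span (v ` {1..k})"
  shows "eigval M k * (x \<bullet> x) \<le> x \<bullet> (M *v x)"
proof -
  note on = eigen_decomposition_orthonormal[OF v]
  have "eigval M k * (v i \<bullet> x)\<^sup>2 \<le> eigval M i * (v i \<bullet> x)\<^sup>2" if "i \<in> {1..CARD('n)}" for i
  proof (cases "i \<le> k")
    case True
    then show ?thesis
      using that k by (intro mult_right_mono eigval_antimono eigen_decomposition_sym[OF v]) auto
  next
    case False
    then show ?thesis using orthonormal_span_inner_eq_0[OF on k(2) x that] by simp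
  qed
  then show ?thesis
    unfolding eigen_decomposition_quad[OF v] orthonormal_norm_sq[OF on] sum_distrib_left
    by (intro sum_mono) auto
qed

text \<open>
  A dimension count gives \<open>k\<close> orthonormal vectors common to the span of the top \<open>r + 1\<close> eigenvectors
  of \<open>M\<close> and to the span of the top \<open>n - r + k - 1\<close> eigenvectors of \<open>G\<close>; complementarity makes \<open>X\<close>
  vanish on the latter. Testing the perturbation against the projector onto these vectors, whose
  Frobenius norm is \<open>sqrt k\<close>, shows that it is too small for \<open>M\<close> to have \<open>r + 1\<close> positive eigenvalues.
\<close>
lemma eigval_nonpos_of_perturbation:
  fixes M G X :: "real^'n^'n"
  assumes M: "M \<in> sym_mats" and X: "X \<in> psd_mats" and G: "G \<in> psd_mats" and compl: "X \<bullet> G = 0"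
    and r: "r < CARD('n)" and k: "1 \<le> k" "CARD('n) - r + k - 1 \<le> CARD('n)"
    and pos: "0 < eigval G (CARD('n) - r + k - 1)" and \<eta>: "0 < \<eta>"
    and pert: "norm (M - (X - \<eta> *\<^sub>R G)) \<le> \<eta> * (sqrt k * eigval G (CARD('n) - r + k - 1))"
  shows "eigval M (r + 1) \<le> 0"
proof (rule ccontr)
  assume neg: "\<not> eigval M (r + 1) \<le> 0"
  define m where "m = CARD('n) - r + k - 1"
  define c where "c = eigval G m"
  define E where "E = M - (X - \<eta> *\<^sub>R G)"
  have m: "1 \<le> m" "m \<le> CARD('n)" using r k by (auto simp: m_def)
  obtain v where v: "eigen_decomposition M v" using exists_eigen_decomposition[OF M] .
  obtain w where w: "eigen_decomposition G w" using exists_eigen_decomposition[OF psd_mats_sym[OF G]] .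
  note von = eigen_decomposition_orthonormal[OF v] and won = eigen_decomposition_orthonormal[OF w]
  define V where "V = span (v ` {1..r + 1})"
  define W where "W = span (w ` {1..m})"
  \<comment> \<open>In the eigenbasis of \<open>G\<close>, \<open>X \<bullet> G\<close> is a sum of
    nonnegative terms, so each of them vanishes; the first \<open>m\<close> eigenvalues are
    positive, so it is the form of \<open>X\<close> that vanishes at \<open>w i\<close>.\<close>
  have "X *v w i = 0" if "i \<in> {1..m}" for i
  proof -
    have "X \<bullet> G = (\<Sum>j=1..CARD('n). eigval G j * (w j \<bullet> (X *v w j)))"
      by (subst eigen_decomposition_eq[OF w]) (simp add: inner_sum_right inner_outer)
    then have "eigval G i * (w i \<bullet> (X *v w i)) = 0"
      using that m psd_mats_eigval_nonneg[OF G] psd_mats_quad[OF X] unfolding compl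
      by (subst (asm) eq_commute, subst (asm) sum_nonneg_eq_0_iff) auto
    moreover have "c \<le> eigval G i"
      unfolding c_def using that m by (intro eigval_antimono[OF psd_mats_sym[OF G]]) auto
    ultimately show ?thesis
      using pos by (intro psd_mats_quad_eq_0[OF X]) (auto simp: c_def m_def)
  qed
  then have "W \<subseteq> {x. X *v x = 0}"
    unfolding W_def by (intro span_minimal)
      (auto simp: subspace_def matrix_vector_right_distrib matrix_vector_mult_scaleR)
  then have XW: "X *v x = 0" if "x \<in> W" for x using that by blast
  have quad: "\<eta> * c * (x \<bullet> x) < x \<bullet> (E *v x)" if x: "x \<in> V \<inter> W" "x \<noteq> 0" for x
  proof -
    have "eigval M (r + 1) * (x \<bullet> x) \<le> x \<bullet> (M *v x)"
      using x r by (intro quad_ge_eigval[OF v]) (auto simp: V_def)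
    moreover have "0 < eigval M (r + 1) * (x \<bullet> x)" using neg x by simp
    moreover have "c * (x \<bullet> x) \<le> x \<bullet> (G *v x)"
      using x m unfolding c_def by (intro quad_ge_eigval[OF w]) (auto simp: W_def)
    then have "\<eta> * (c * (x \<bullet> x)) \<le> \<eta> * (x \<bullet> (G *v x))" using \<eta> by simp
    moreover have "x \<bullet> (E *v x) = x \<bullet> (M *v x) + \<eta> * (x \<bullet> (G *v x))"
      using XW x by (simp add: E_def matrix_vector_mult_diff_rdistrib inner_diff_right
        scaleR_matrix_vector_assoc[symmetric] inner_add_right)
    ultimately show ?thesis by linarith
  qed
  \<comment> \<open>The dimensions \<open>r + 1\<close> and \<open>n - r + k - 1\<close> add up to
    \<open>n + k\<close>.\<close>
  have "dim (V \<inter> W) \<ge> k"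
  proof -
    have "dim {x + y |x y. x \<in> V \<and> y \<in> W} \<le> CARD('n)"
      using dim_subset_UNIV[of "{x + y |x y. x \<in> V \<and> y \<in> W}"] by simp
    moreover have "dim {x + y |x y. x \<in> V \<and> y \<in> W} + dim (V \<inter> W) = dim V + dim W"
      unfolding V_def W_def by (intro dim_sums_Int subspace_span)
    moreover have "dim V = r + 1" "dim W = m"
      unfolding V_def W_def using orthonormal_dim_span[OF von] orthonormal_dim_span[OF won] r m by auto
    ultimately show ?thesis using r by (simp add: m_def)
  qed
  moreover have "subspace (V \<inter> W)"
    unfolding V_def W_def by (intro subspace_inter subspace_span)
  then obtain B where B: "B \<subseteq> V \<inter> W" "pairwise orthogonal B" "\<And>x. x \<in> B \<Longrightarrow> norm x = 1"
    "card B = dim (V \<inter> W)"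
    by (rule orthonormal_basis_subspace) blast
  ultimately obtain C where C: "C \<subseteq> B" "card C = k" "finite C"
    using obtain_subset_with_card_n by metis
  have CC: "x \<bullet> x = 1" "x \<in> V \<inter> W" "x \<noteq> 0" if "x \<in> C" for x
    using that B C by (auto simp flip: norm_eq_1) (metis norm_zero zero_neq_one subset_iff)
  have C_orth: "x \<bullet> y = (if x = y then 1 else 0)" if "x \<in> C" "y \<in> C" for x y
    using that B(2) C(1) CC(1)[of x] by (auto simp: pairwise_def orthogonal_def)
  define Q where "Q = (\<Sum>x\<in>C. outer x)"
  have "Q \<bullet> Q = (\<Sum>x\<in>C. \<Sum>y\<in>C. if x = y then 1 else 0)"
    unfolding Q_def inner_sum_left inner_sum_right outer_inner_outer
    by (intro sum.cong refl) (simp add: C_orth)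
  also have "\<dots> = k" using C by simp
  finally have normQ: "norm Q = sqrt k" by (simp add: norm_eq_sqrt_inner)
  have "\<eta> * c * k = (\<Sum>x\<in>C. \<eta> * c * (x \<bullet> x))" using C CC by simp
  also have "\<dots> < (\<Sum>x\<in>C. x \<bullet> (E *v x))"
    using CC(2,3) C k quad by (intro sum_strict_mono) force+
  also have "\<dots> = E \<bullet> Q" by (simp add: Q_def inner_sum_right inner_outer)
  also have "\<dots> \<le> norm E * sqrt k" using norm_cauchy_schwarz[of E Q] by (simp add: normQ)
  also have "\<dots> \<le> \<eta> * (sqrt k * c) * sqrt k"
    using pert by (intro mult_right_mono) (auto simp: E_def c_def m_def)
  also have "\<dots> = \<eta> * c * k" by simp
  finally show False by simp
qed

section \<open>The saddle operator of a smooth convex program\<close>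

lemma nonneg_vecs_eq: "nonneg_vecs = (\<Inter>i. {l :: real^'d. axis i 1 \<bullet> l \<ge> 0})"
  by (auto simp: nonneg_vecs_def inner_axis')

lemma closed_nonneg_vecs: "closed (nonneg_vecs :: (real^'d) set)"
  unfolding nonneg_vecs_eq by (intro closed_INT ballI closed_halfspace_ge)

lemma convex_nonneg_vecs: "convex (nonneg_vecs :: (real^'d) set)"
  unfolding nonneg_vecs_eq by (intro convex_INT convex_halfspace_ge)

lemma zero_in_nonneg_vecs: "0 \<in> nonneg_vecs"
  by (simp add: nonneg_vecs_def)

lemma nonneg_vecs_add: "k \<in> nonneg_vecs \<Longrightarrow> l \<in> nonneg_vecs \<Longrightarrow> k + l \<in> nonneg_vecs"
  by (simp add: nonneg_vecs_def)

lemma l1_norm_le: "(\<Sum>i\<in>UNIV. \<bar>l $ i\<bar>) \<le> sqrt CARD('d) * norm l" for l :: "real^'d"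
proof -
  have "(\<Sum>i\<in>UNIV. \<bar>l $ i\<bar>) = ((\<chi> i. 1) :: real^'d) \<bullet> (\<chi> i. \<bar>l $ i\<bar>)" by (simp add: inner_vec_def)
  also have "\<dots> \<le> norm ((\<chi> i. 1) :: real^'d) * norm (\<chi> i. \<bar>l $ i\<bar>)" by (rule norm_cauchy_schwarz)
  also have "\<dots> = sqrt CARD('d) * norm l" by (simp add: norm_vec_def L2_set_def)
  finally show ?thesis .
qed

lemma norm_le_sqrt_card:
  fixes l :: "real^'d"
  assumes "\<And>i. \<bar>l $ i\<bar> \<le> c" "0 \<le> c"
  shows "norm l \<le> sqrt CARD('d) * c"
proof -
  have "norm l \<le> sqrt (\<Sum>i\<in>(UNIV::'d set). c\<^sup>2)"
    unfolding norm_vec_def L2_set_def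
    using assms by (intro real_sqrt_le_mono sum_mono) (simp add: abs_le_square_iff[symmetric])
  then show ?thesis using assms(2) by (simp add: real_sqrt_mult)
qed

lemma inner_indicator: "(\<chi> i. if P i then 1 else 0) \<bullet> v = (\<Sum>i | P i. v $ i)" for v :: "real^'d"
proof -
  have "(\<Sum>i | P i. v $ i) = (\<Sum>i\<in>UNIV. if P i then v $ i else 0)"
    using sum.inter_filter[of UNIV "\<lambda>i. v $ i" P] by simp
  then show ?thesis by (auto simp: inner_vec_def intro!: sum.cong)
qed

lemma norm_triple_sq: "(norm (a, b, c))\<^sup>2 = (norm a)\<^sup>2 + (norm b)\<^sup>2 + (norm c)\<^sup>2"
  by (simp add: norm_Pair)

lemma norm_le_norm_triple:
  "norm a \<le> norm (a, b, c)" "norm b \<le> norm (a, b, c)" "norm c \<le> norm (a, b, c)"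
  by (rule power2_le_imp_le; simp add: norm_triple_sq)+

text \<open>A slope at \<open>x\<close> larger than that of the secant would lift \<open>f\<close>
  above its chord just after leaving \<open>x\<close>. The line through both points stays in
  \<open>S\<close>, within which the derivative is taken.\<close>

lemma gradient_ineq:
  assumes S: "subspace S" and f: "convex_on S f" "smooth_on S \<beta> f" and xy: "x \<in> S" "y \<in> S"
  shows "gradient S f x \<bullet> (y - x) \<le> f y - f x"
proof (rule ccontr)
  assume neg: "\<not> gradient S f x \<bullet> (y - x) \<le> f y - f x"
  define \<phi> where "\<phi> = (\<lambda>s::real. x + s *\<^sub>R (y - x))"
  have im: "range \<phi> \<subseteq> S"
    using S xy by (auto simp: \<phi>_def subspace_add subspace_scale subspace_diff)
  have "(\<phi> has_derivative (\<lambda>s. s *\<^sub>R (y - x))) (at 0)"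
    unfolding \<phi>_def by (auto intro!: derivative_eq_intros)
  moreover have "(f has_derivative (\<lambda>h. h \<bullet> gradient S f x)) (at (\<phi> 0) within range \<phi>)"
    using is_gradient_gradient[OF S xy(1) f(2)] im has_derivative_subset
    by (auto simp: is_gradient_def \<phi>_def)
  ultimately have "((\<lambda>s. f (\<phi> s)) has_derivative (\<lambda>s. (s *\<^sub>R (y - x)) \<bullet> gradient S f x)) (at 0)"
    by (rule has_derivative_in_compose)
  then have "((\<lambda>s. f (\<phi> s)) has_real_derivative gradient S f x \<bullet> (y - x)) (at 0)"
    by (rule has_derivative_imp_has_field_derivative) (simp add: inner_commute)
  then have "((\<lambda>s. f (\<phi> s) - s * (f y - f x)) has_real_derivative
      gradient S f x \<bullet> (y - x) - (f y - f x)) (at 0)"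
    by (auto intro!: derivative_eq_intros)
  moreover have "0 < gradient S f x \<bullet> (y - x) - (f y - f x)" using neg by simp
  ultimately have "\<exists>e>0. \<forall>s>0. s < e \<longrightarrow> f (\<phi> 0) - 0 * (f y - f x) < f (\<phi> (0 + s)) - (0 + s) * (f y - f x)"
    by (rule DERIV_pos_inc_right)
  then obtain e where "0 < e"
    and e: "\<And>s. 0 < s \<Longrightarrow> s < e \<Longrightarrow> f (\<phi> 0) < f (\<phi> s) - s * (f y - f x)"
    by auto
  define s where "s = min (e / 2) 1"
  have s: "0 < s" "s < e" "s \<le> 1" using \<open>0 < e\<close> by (auto simp: s_def)
  have "f ((1 - s) *\<^sub>R x + s *\<^sub>R y) \<le> (1 - s) * f x + s * f y"
    using f(1) xy s by (intro convex_onD) auto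
  moreover have "(1 - s) *\<^sub>R x + s *\<^sub>R y = \<phi> s" by (simp add: \<phi>_def algebra_simps)
  ultimately show False using e[OF s(1,2)] by (simp add: \<phi>_def algebra_simps)
qed

lemma gradient_lipschitz:
  "smooth_on S \<beta> f \<Longrightarrow> x \<in> S \<Longrightarrow> y \<in> S \<Longrightarrow> norm (gradient S f x - gradient S f y) \<le> \<beta> * norm (x - y)"
  by (auto simp: smooth_on_def lipschitz_on_def dist_norm)

lemma smooth_on_nonneg: "smooth_on S \<beta> f \<Longrightarrow> 0 \<le> \<beta>"
  by (simp add: smooth_on_def lipschitz_on_def)

lemma gradient_mem: "subspace S \<Longrightarrow> x \<in> S \<Longrightarrow> smooth_on S \<beta> f \<Longrightarrow> gradient S f x \<in> S"
  using is_gradient_gradient by (auto simp: is_gradient_def)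

section \<open>The constraint map, its adjoint and its norm\<close>

lemma inner_lin_op_adj: "lin_op_adj A y \<bullet> H = y \<bullet> lin_op A H"
  by (simp add: lin_op_adj_def lin_op_def inner_vec_def[of y] inner_sum_left inner_commute[of "A _"])

lemma lin_op_diff: "lin_op A (X - Y) = lin_op A X - lin_op A Y"
  by (simp add: lin_op_def vec_eq_iff inner_diff_left)

lemma lin_op_scale: "lin_op A (c *\<^sub>R X) = c *\<^sub>R lin_op A X"
  by (simp add: lin_op_def vec_eq_iff)

lemma lin_op_adj_diff: "lin_op_adj A (y - w) = lin_op_adj A y - lin_op_adj A w"
  by (simp add: lin_op_adj_def scaleR_left_diff_distrib sum_subtractf)

lemma linear_lin_op: "linear (lin_op A)"
  by (rule linearI) (simp_all add: lin_op_def vec_eq_iff inner_add_left)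

lemma lin_op_norm_bound:
  fixes A :: "'m::finite \<Rightarrow> real^'n^'n"
  assumes "X \<in> sym_mats"
  shows "norm (lin_op A X) \<le> lin_op_norm A * norm X"
proof (cases "X = 0")
  case False
  obtain B where B: "\<And>X. norm (lin_op A X) \<le> B * norm X" "0 < B"
    using linear_bounded_pos[OF linear_lin_op] by blast
  have "norm (lin_op A ((1 / norm X) *\<^sub>R X)) \<le> lin_op_norm A"
    unfolding lin_op_norm_def
  proof (rule cSUP_upper)
    show "(1 / norm X) *\<^sub>R X \<in> {X \<in> sym_mats. norm X \<le> 1}"
      using assms by (simp add: subspace_scale subspace_sym_mats)
    show "bdd_above ((\<lambda>X. norm (lin_op A X)) ` {X \<in> sym_mats. norm X \<le> 1})"
    proof (rule bdd_aboveI2)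
      fix X :: "real^'n^'n" assume "X \<in> {X \<in> sym_mats. norm X \<le> 1}"
      then have "B * norm X \<le> B * 1" using B(2) by (intro mult_left_mono) auto
      then show "norm (lin_op A X) \<le> B" using B(1)[of X] by simp
    qed
  qed
  then show ?thesis using False by (simp add: lin_op_scale divide_simps)
qed (simp add: linear_0 linear_lin_op)

lemma lin_op_norm_nonneg: "0 \<le> lin_op_norm A" for A :: "'m::finite \<Rightarrow> real^'n^'n"
proof -
  have "mat 1 \<in> (sym_mats :: (real^'n^'n) set)" by (simp add: sym_mats_def transpose_mat)
  moreover have "(mat 1 :: real^'n^'n) \<noteq> 0"
    by (simp add: mat_def vec_eq_iff)
  ultimately show ?thesis
    using order_trans[OF norm_ge_zero lin_op_norm_bound[of "mat 1" A]] by (simp add: zero_le_mult_iff)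
qed

text \<open>\<open>lin_op_adj A y\<close> is itself symmetric, so the bound for
  \<open>lin_op A\<close>, available on symmetric matrices, may be applied to it.\<close>

lemma lin_op_adj_norm_bound:
  assumes "\<And>i. A i \<in> sym_mats"
  shows "norm (lin_op_adj A y) \<le> lin_op_norm A * norm y"
proof -
  let ?H = "lin_op_adj A y"
  have "?H \<in> sym_mats"
    unfolding lin_op_adj_def using assms by (intro subspace_sum subspace_scale subspace_sym_mats)
  then have "norm y * norm (lin_op A ?H) \<le> norm y * (lin_op_norm A * norm ?H)"
    by (intro mult_left_mono lin_op_norm_bound) auto
  moreover have "(norm ?H)\<^sup>2 \<le> norm y * norm (lin_op A ?H)"
    using norm_cauchy_schwarz[of y "lin_op A ?H"] by (simp add: power2_norm_eq_inner inner_lin_op_adj)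
  ultimately have "norm ?H * norm ?H \<le> (lin_op_norm A * norm y) * norm ?H"
    by (simp add: power2_eq_square mult_ac)
  then show ?thesis
    using lin_op_norm_nonneg[of A] by (cases "?H = 0") auto
qed

text \<open>Origin of the constant 2/3. The weight in Young's inequality leaves at most 1/2 + 1/6 in
  front of \<open>a\<^sup>2\<close>, and \<open>(6 * p\<^sup>2 + 1) * (1 / 2 - p\<^sup>2)\<close> in
  front of the other squares, which attains its maximum 2/3 at
  \<open>p\<^sup>2 = 1 / 6\<close>.\<close>

lemma saddle_lipschitz_constant:
  fixes p q s a b c :: real
  assumes "p\<^sup>2 + q\<^sup>2 \<le> 1 / 4" "s\<^sup>2 \<le> 1 / 4"
  shows "(p * a + q * b + s * c)\<^sup>2 + (q * a)\<^sup>2 + (s * a)\<^sup>2 \<le> 2 / 3 * (a\<^sup>2 + b\<^sup>2 + c\<^sup>2)"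
proof -
  define R where "R = q\<^sup>2 + s\<^sup>2"
  define e where "e = q * b + s * c"
  have R: "0 \<le> R" "p\<^sup>2 + R \<le> 1 / 2" using assms by (auto simp: R_def)
  have e: "e\<^sup>2 \<le> R * (b\<^sup>2 + c\<^sup>2)"
    using zero_le_power2[of "q * c - s * b"] by (simp add: e_def R_def power2_eq_square algebra_simps)
  have "(p * a + e)\<^sup>2 \<le> p\<^sup>2 * a\<^sup>2 + a\<^sup>2 / 6 + (6 * p\<^sup>2 + 1) * e\<^sup>2"
    using zero_le_power2[of "a - 6 * p * e"] by (simp add: power2_eq_square algebra_simps)
  also have "(6 * p\<^sup>2 + 1) * e\<^sup>2 \<le> (6 * p\<^sup>2 + 1) * (R * (b\<^sup>2 + c\<^sup>2))"
    using e by (intro mult_left_mono) auto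
  also have "\<dots> = (6 * p\<^sup>2 + 1) * R * (b\<^sup>2 + c\<^sup>2)" by simp
  also have "\<dots> \<le> 2 / 3 * (b\<^sup>2 + c\<^sup>2)"
  proof (rule mult_right_mono)
    have "(6 * p\<^sup>2 + 1) * R \<le> (6 * p\<^sup>2 + 1) * (1 / 2 - p\<^sup>2)"
      using R by (intro mult_left_mono) auto
    also have "\<dots> \<le> 2 / 3"
      using zero_le_power2[of "p\<^sup>2 - 1 / 6"] by (simp add: power2_eq_square algebra_simps)
    finally show "(6 * p\<^sup>2 + 1) * R \<le> 2 / 3" .
  qed simp
  finally have "(p * a + e)\<^sup>2 + R * a\<^sup>2 \<le> (p\<^sup>2 + R + 1 / 6) * a\<^sup>2 + 2 / 3 * (b\<^sup>2 + c\<^sup>2)"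
    by (simp add: algebra_simps)
  also have "(p\<^sup>2 + R + 1 / 6) * a\<^sup>2 \<le> 2 / 3 * a\<^sup>2"
    using R by (intro mult_right_mono) auto
  finally show ?thesis
    by (simp add: e_def R_def power_mult_distrib algebra_simps)
qed

section \<open>The Lagrangian and its saddle operator\<close>

locale smooth_convex_program =
  fixes f :: "real^'n^'n \<Rightarrow> real" and g :: "real^'n^'n \<Rightarrow> real^'d"
    and A :: "'m::finite \<Rightarrow> real^'n^'n" and b :: "real^'m" and \<beta> \<beta>g :: real
  assumes A_sym: "\<And>i. A i \<in> sym_mats"
    and f_convex: "convex_on sym_mats f" and f_smooth: "smooth_on sym_mats \<beta> f"
    and g_convex: "\<And>i. convex_on sym_mats (\<lambda>X. g X $ i)"
    and g_smooth: "\<And>i. smooth_on sym_mats \<beta>g (\<lambda>X. g X $ i)"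
begin

abbreviation L where "L \<equiv> lagrangian f g A b"

abbreviation grad_g where "grad_g i \<equiv> gradient sym_mats (\<lambda>X. g X $ i)"

definition cone :: "((real^'n^'n) \<times> (real^'m) \<times> (real^'d)) set" where
  "cone = psd_mats \<times> UNIV \<times> nonneg_vecs"

fun saddle_op :: "(real^'n^'n) \<times> (real^'m) \<times> (real^'d) \<Rightarrow> (real^'n^'n) \<times> (real^'m) \<times> (real^'d)" where
  "saddle_op (X, y, l) = (grad_X L X y l, lin_op A X - b, - g X)"

lemma \<beta>_nonneg: "0 \<le> \<beta>" and \<beta>g_nonneg: "0 \<le> \<beta>g"
  using smooth_on_nonneg f_smooth g_smooth by blast+

lemma grad_X_L:
  "X \<in> sym_mats \<Longrightarrow> grad_X L X y l = gradient sym_mats f X - lin_op_adj A y + (\<Sum>i\<in>UNIV. l $ i *\<^sub>R grad_g i X)"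
  by (rule grad_X_lagrangian[OF _ f_smooth g_smooth A_sym])

lemma grad_X_L_sym: "X \<in> sym_mats \<Longrightarrow> grad_X L X y l \<in> sym_mats"
  unfolding grad_X_L lin_op_adj_def
  using A_sym f_smooth g_smooth
  by (intro subspace_add subspace_diff subspace_sum subspace_scale gradient_mem subspace_sym_mats) auto

lemma grad_X_L_ineq:
  assumes "X \<in> sym_mats" "Z \<in> sym_mats" "l \<in> nonneg_vecs"
  shows "grad_X L Z y l \<bullet> (X - Z) \<le> L X y l - L Z y l"
proof -
  have "l $ i * (grad_g i Z \<bullet> (X - Z)) \<le> l $ i * (g X $ i - g Z $ i)" for i
    using assms by (intro mult_left_mono gradient_ineq[OF subspace_sym_mats g_convex g_smooth])
      (auto simp: nonneg_vecs_def)
  then have "(\<Sum>i\<in>UNIV. l $ i * (grad_g i Z \<bullet> (X - Z))) \<le> l \<bullet> (g X - g Z)"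
    by (simp add: inner_vec_def sum_mono)
  moreover have "gradient sym_mats f Z \<bullet> (X - Z) \<le> f X - f Z"
    using assms by (intro gradient_ineq[OF subspace_sym_mats f_convex f_smooth])
  ultimately show ?thesis
    unfolding grad_X_L[OF assms(2)] lagrangian_def
    by (simp add: inner_add_left inner_diff_left inner_sum_left inner_lin_op_adj lin_op_diff inner_diff_right
        right_diff_distrib sum_subtractf)
qed

text \<open>Convexity is used only in the matrix variable; the Lagrangian is affine in the dual
  variables, so their contribution is exact.\<close>

lemma saddle_op_gap:
  assumes "X \<in> sym_mats" "Z \<in> sym_mats" "\<mu> \<in> nonneg_vecs"
  shows "L Z y l - L X w \<mu> \<le> saddle_op (Z, w, \<mu>) \<bullet> ((Z, w, \<mu>) - (X, y, l))"
  using grad_X_L_ineq[OF assms, of w]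
  by (simp add: lagrangian_def inner_diff_left inner_diff_right inner_commute)

text \<open>Adding the gap inequality in both directions cancels the Lagrangian values.\<close>

lemma saddle_op_mono:
  assumes "u \<in> cone" "v \<in> cone"
  shows "0 \<le> (saddle_op u - saddle_op v) \<bullet> (u - v)"
proof -
  obtain X y l Z w \<mu> where uv: "u = (X, y, l)" "v = (Z, w, \<mu>)" by (metis surj_pair)
  have "L X w \<mu> - L Z y l \<le> saddle_op u \<bullet> (u - v)" "L Z y l - L X w \<mu> \<le> saddle_op v \<bullet> (v - u)"
    using assms unfolding uv
    by (intro saddle_op_gap; simp add: cone_def psd_mats_sym)+
  then show ?thesis by (simp add: inner_diff_left inner_diff_right)
qed

text \<open>The difference of products is split with the multiplier of the first point and the
  constraint gradient of the second, hence \<open>\<Lambda>\<close> is asked of \<open>l\<close> and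
  \<open>\<Gamma>\<close> of \<open>Z\<close>.\<close>

lemma norm_grad_X_L_diff:
  assumes "X \<in> sym_mats" "Z \<in> sym_mats"
    and "(\<Sum>i\<in>UNIV. \<bar>l $ i\<bar>) \<le> \<Lambda>" and "\<And>i. norm (grad_g i Z) \<le> \<Gamma>"
  shows "norm (grad_X L X y l - grad_X L Z w \<mu>) \<le>
    (\<beta> + \<Lambda> * \<beta>g) * norm (X - Z) + lin_op_norm A * norm (y - w) + sqrt CARD('d) * \<Gamma> * norm (l - \<mu>)"
proof -
  have \<Gamma>: "0 \<le> \<Gamma>" using assms(4) norm_ge_zero order_trans by blast
  have norm_tri: "norm (a + b - c + d) \<le> norm a + norm b + norm c + norm d" for a b c d :: "real^'n^'n"
    using norm_triangle_ineq[of "a + b - c" d] norm_triangle_ineq4[of "a + b" c] norm_triangle_ineq[of a b]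
    by linarith
  have eq: "grad_X L X y l - grad_X L Z w \<mu> =
      (gradient sym_mats f X - gradient sym_mats f Z) + (\<Sum>i\<in>UNIV. l $ i *\<^sub>R (grad_g i X - grad_g i Z))
      - lin_op_adj A (y - w) + (\<Sum>i\<in>UNIV. (l - \<mu>) $ i *\<^sub>R grad_g i Z)"
    unfolding grad_X_L[OF assms(1)] grad_X_L[OF assms(2)]
    by (simp add: lin_op_adj_diff scaleR_right_diff_distrib scaleR_left_diff_distrib sum_subtractf)
  have "norm (grad_X L X y l - grad_X L Z w \<mu>) \<le> norm (gradient sym_mats f X - gradient sym_mats f Z)
      + norm (\<Sum>i\<in>UNIV. l $ i *\<^sub>R (grad_g i X - grad_g i Z)) + norm (lin_op_adj A (y - w))
      + norm (\<Sum>i\<in>UNIV. (l - \<mu>) $ i *\<^sub>R grad_g i Z)"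
    unfolding eq by (rule norm_tri)
  also have "\<dots> \<le> \<beta> * norm (X - Z) + \<Lambda> * \<beta>g * norm (X - Z) + lin_op_norm A * norm (y - w)
      + sqrt CARD('d) * \<Gamma> * norm (l - \<mu>)"
  proof (intro add_mono)
    show "norm (gradient sym_mats f X - gradient sym_mats f Z) \<le> \<beta> * norm (X - Z)"
      using gradient_lipschitz[OF f_smooth assms(1,2)] .
    show "norm (lin_op_adj A (y - w)) \<le> lin_op_norm A * norm (y - w)"
      by (rule lin_op_adj_norm_bound[OF A_sym])
    have "norm (\<Sum>i\<in>UNIV. l $ i *\<^sub>R (grad_g i X - grad_g i Z)) \<le> (\<Sum>i\<in>UNIV. \<bar>l $ i\<bar> * (\<beta>g * norm (X - Z)))"
      using gradient_lipschitz[OF g_smooth assms(1,2)]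
      by (intro sum_norm_le) (simp add: mult_left_mono)
    also have "\<dots> \<le> \<Lambda> * (\<beta>g * norm (X - Z))"
      unfolding sum_distrib_right[symmetric] using assms(3) \<beta>g_nonneg by (intro mult_right_mono) auto
    finally show "norm (\<Sum>i\<in>UNIV. l $ i *\<^sub>R (grad_g i X - grad_g i Z)) \<le> \<Lambda> * \<beta>g * norm (X - Z)"
      by simp
    have "norm (\<Sum>i\<in>UNIV. (l - \<mu>) $ i *\<^sub>R grad_g i Z) \<le> (\<Sum>i\<in>UNIV. \<bar>(l - \<mu>) $ i\<bar> * \<Gamma>)"
      using assms(4) by (intro sum_norm_le) (simp add: mult_left_mono)
    also have "\<dots> \<le> sqrt CARD('d) * norm (l - \<mu>) * \<Gamma>"
      unfolding sum_distrib_right[symmetric] using \<Gamma> by (intro mult_right_mono l1_norm_le)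
    finally show "norm (\<Sum>i\<in>UNIV. (l - \<mu>) $ i *\<^sub>R grad_g i Z) \<le> sqrt CARD('d) * \<Gamma> * norm (l - \<mu>)"
      by (simp add: mult_ac)
  qed
  finally show ?thesis by (simp add: algebra_simps)
qed

text \<open>Convexity at each endpoint bounds the increment from one side, so gradient bounds at the
  two endpoints suffice.\<close>

lemma norm_g_diff:
  assumes "X \<in> sym_mats" "Z \<in> sym_mats" "\<And>i. norm (grad_g i X) \<le> \<Gamma>" "\<And>i. norm (grad_g i Z) \<le> \<Gamma>"
  shows "norm (g X - g Z) \<le> sqrt CARD('d) * \<Gamma> * norm (X - Z)"
proof -
  have *: "g X $ i - g Z $ i \<le> \<Gamma> * norm (X - Z)"
    if "X \<in> sym_mats" "Z \<in> sym_mats" "norm (grad_g i X) \<le> \<Gamma>" for X Z i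
  proof -
    have "g X $ i - g Z $ i \<le> grad_g i X \<bullet> (X - Z)"
      using gradient_ineq[OF subspace_sym_mats g_convex g_smooth that(1,2), of i]
      unfolding inner_diff_right by linarith
    also have "\<dots> \<le> norm (grad_g i X) * norm (X - Z)" by (rule norm_cauchy_schwarz)
    also have "\<dots> \<le> \<Gamma> * norm (X - Z)" using that(3) by (rule mult_right_mono) simp
    finally show ?thesis .
  qed
  have "\<bar>(g X - g Z) $ i\<bar> \<le> \<Gamma> * norm (X - Z)" for i
    using *[of X Z i] *[of Z X i] assms by (auto simp: norm_minus_commute)
  from norm_le_sqrt_card[OF this] show ?thesis
    using order_trans[OF norm_ge_zero assms(3)] by (simp add: mult_ac)
qed

end

section \<open>Optimality and Lipschitz estimates around the saddle point\<close>

locale local_saddle_point = smooth_convex_program f g A b \<beta> \<beta>g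
  for f :: "real^'n^'n \<Rightarrow> real" and g :: "real^'n^'n \<Rightarrow> real^'d"
    and A :: "'m::finite \<Rightarrow> real^'n^'n" and b :: "real^'m" and \<beta> \<beta>g :: real +
  fixes Xs :: "real^'n^'n" and ys :: "real^'m" and ls :: "real^'d" and \<delta> \<Lambda> \<Gamma> \<eta> :: real
  assumes Xs_feasible: "Xs \<in> feasible g A b"
    and dual: "dual_solution L Xs ys ls"
    and \<Lambda>: "\<And>l. l \<in> nonneg_vecs \<Longrightarrow> norm (l - ls) \<le> 2 * \<delta> \<Longrightarrow> (\<Sum>i\<in>UNIV. \<bar>l $ i\<bar>) \<le> \<Lambda>"
    and \<Gamma>: "\<And>X i. X \<in> psd_mats \<Longrightarrow> norm (X - Xs) \<le> 2 * \<delta> \<Longrightarrow> norm (grad_g i X) \<le> \<Gamma>"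
    and \<delta>_nonneg: "0 \<le> \<delta>"
    and \<eta>_pos: "0 < \<eta>"
    and \<eta>_le: "(\<eta> * (\<beta> + \<Lambda> * \<beta>g))\<^sup>2 + (\<eta> * lin_op_norm A)\<^sup>2 \<le> 1 / 4" "\<eta> * (sqrt CARD('d) * \<Gamma>) \<le> 1 / 2"
begin

lemma Xs_psd: "Xs \<in> psd_mats" and ls_nonneg: "ls \<in> nonneg_vecs" and lin_op_Xs: "lin_op A Xs = b"
  using Xs_feasible dual by (auto simp: feasible_def dual_solution_def)

lemma Xs_sym: "Xs \<in> sym_mats"
  using Xs_psd by (rule psd_mats_sym)

lemma inner_g_Xs_le: "l \<in> nonneg_vecs \<Longrightarrow> l \<bullet> g Xs \<le> 0"
  using Xs_feasible
  by (auto simp: feasible_def nonneg_vecs_def inner_vec_def intro!: sum_nonpos mult_nonneg_nonpos)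

lemma L_Xs: "L Xs y l = f Xs + l \<bullet> g Xs"
  by (simp add: lagrangian_def lin_op_Xs)

lemma inner_ls_g_Xs: "ls \<bullet> g Xs = 0"
proof (rule antisym[OF inner_g_Xs_le[OF ls_nonneg]])
  have "L Xs ys 0 \<le> L Xs ys ls" using dual zero_in_nonneg_vecs by (auto simp: dual_solution_def)
  then show "0 \<le> ls \<bullet> g Xs" by (simp add: L_Xs)
qed

lemma L_ge: "X \<in> psd_mats \<Longrightarrow> f Xs \<le> L X ys ls"
  using dual by (auto simp: dual_solution_def L_Xs inner_ls_g_Xs)

lemma \<Lambda>_nonneg: "0 \<le> \<Lambda>"
proof -
  have "(\<Sum>i\<in>UNIV. \<bar>ls $ i\<bar>) \<le> \<Lambda>" using ls_nonneg \<delta>_nonneg by (intro \<Lambda>) auto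
  moreover have "0 \<le> (\<Sum>i\<in>UNIV. \<bar>ls $ i\<bar>)" by (intro sum_nonneg) simp
  ultimately show ?thesis by linarith
qed

lemma \<Gamma>_nonneg: "0 \<le> \<Gamma>"
proof -
  have "norm (grad_g undefined Xs) \<le> \<Gamma>" using Xs_psd \<delta>_nonneg by (intro \<Gamma>) auto
  then show ?thesis by (rule order_trans[OF norm_ge_zero])
qed

abbreviation ustar where "ustar \<equiv> (Xs, ys, ls)"

text \<open>
  Convexity bounds the gradient at points \<open>Xs + s (X - Xs)\<close> in the direction \<open>X - Xs\<close> from below by
  \<open>0\<close>; by its Lipschitz continuity the bound passes to the limit \<open>s \<rightarrow> 0\<close>.
\<close>
lemma grad_X_optimal:
  assumes X: "X \<in> psd_mats"
  shows "0 \<le> grad_X L Xs ys ls \<bullet> (X - Xs)"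
proof (rule ccontr)
  assume neg: "\<not> 0 \<le> grad_X L Xs ys ls \<bullet> (X - Xs)"
  define c where "c = - (grad_X L Xs ys ls \<bullet> (X - Xs))"
  define C where "C = (\<beta> + \<Lambda> * \<beta>g) * norm (X - Xs) * norm (X - Xs)"
  have c: "0 < c" using neg by (simp add: c_def)
  have C: "0 \<le> C" using \<beta>_nonneg \<beta>g_nonneg \<Lambda>_nonneg by (simp add: C_def)
  \<comment> \<open>Chosen so that \<open>s * C < c\<close>; the summand 1 keeps the denominator
    positive when \<open>C = 0\<close>.\<close>
  define s where "s = min 1 (c / (2 * (C + 1)))"
  define Y where "Y = Xs + s *\<^sub>R (X - Xs)"
  have s: "0 < s" "s \<le> 1" "s * C < c"
  proof -
    have "s * C \<le> c / (2 * (C + 1)) * C" using C by (intro mult_right_mono) (auto simp: s_def)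
    also have "\<dots> < c" using c C by (simp add: divide_simps)
    finally show "s * C < c" .
  qed (use c C in \<open>auto simp: s_def\<close>)
  have "Y = (1 - s) *\<^sub>R Xs + s *\<^sub>R X" by (simp add: Y_def algebra_simps)
  then have Y: "Y \<in> psd_mats"
    using convex_psd_mats X Xs_psd s by (auto simp: convex_def)
  have "grad_X L Y ys ls \<bullet> (Xs - Y) \<le> L Xs ys ls - L Y ys ls"
    using Y Xs_sym ls_nonneg psd_mats_sym by (intro grad_X_L_ineq) auto
  also have "\<dots> \<le> 0" using L_ge[OF Y] by (simp add: L_Xs inner_ls_g_Xs)
  finally have "0 \<le> grad_X L Y ys ls \<bullet> (X - Xs)"
    using s by (simp add: Y_def mult_le_0_iff zero_le_mult_iff)
  then have "c \<le> (grad_X L Y ys ls - grad_X L Xs ys ls) \<bullet> (X - Xs)"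
    by (simp add: c_def inner_diff_left)
  also have "\<dots> \<le> norm (grad_X L Y ys ls - grad_X L Xs ys ls) * norm (X - Xs)"
    by (rule norm_cauchy_schwarz)
  also have "\<dots> \<le> ((\<beta> + \<Lambda> * \<beta>g) * norm (Y - Xs)) * norm (X - Xs)"
  proof (rule mult_right_mono)
    show "norm (grad_X L Y ys ls - grad_X L Xs ys ls) \<le> (\<beta> + \<Lambda> * \<beta>g) * norm (Y - Xs)"
      using norm_grad_X_L_diff[OF psd_mats_sym[OF Y] Xs_sym, of ls \<Lambda> \<Gamma> ys ys ls] \<Lambda>[OF ls_nonneg] \<Gamma>[OF Xs_psd]
        \<delta>_nonneg by simp
  qed simp
  also have "\<dots> = s * C" using s by (simp add: Y_def C_def)
  finally show False using s by simp
qed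

text \<open>Adding \<open>outer v\<close> to \<open>Xs\<close> stays in the cone, and first-order
  optimality in this direction is the quadratic form at \<open>v\<close>.\<close>

lemma GL_psd: "grad_X L Xs ys ls \<in> psd_mats"
proof -
  have "0 \<le> v \<bullet> (grad_X L Xs ys ls *v v)" for v
    using grad_X_optimal[OF psd_mats_add[OF Xs_psd outer_in_psd_mats], of v] by (simp add: inner_outer)
  then show ?thesis using grad_X_L_sym[OF Xs_sym] by (simp add: psd_mats_def)
qed

text \<open>Testing optimality at \<open>0\<close> and at \<open>Xs + Xs\<close> gives both
  signs.\<close>

lemma Xs_GL: "Xs \<bullet> grad_X L Xs ys ls = 0"
  using grad_X_optimal[OF psd_mats_zero] grad_X_optimal[OF psd_mats_add[OF Xs_psd Xs_psd]]
  by (simp add: inner_commute)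

lemma saddle_op_solution:
  assumes "v \<in> cone"
  shows "0 \<le> saddle_op ustar \<bullet> (v - ustar)"
proof -
  obtain X y l where v1: "v = (X, y, l)" by (metis surj_pair)
  then have v: "v = (X, y, l)" "X \<in> psd_mats" "l \<in> nonneg_vecs"
    using assms by (auto simp: cone_def)
  then show ?thesis
    using grad_X_optimal[OF v(2)] inner_g_Xs_le[OF v(3)] inner_ls_g_Xs
    by (simp add: lin_op_Xs inner_diff_right inner_commute)
qed

lemma near_ustar:
  assumes "norm ((X, y, l) - ustar) \<le> 2 * \<delta>"
  shows "norm (X - Xs) \<le> 2 * \<delta>" "norm (l - ls) \<le> 2 * \<delta>"
  using assms norm_le_norm_triple[where a = "X - Xs" and b = "y - ys" and c = "l - ls"] by auto

lemma saddle_op_lipschitz: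
  assumes "u \<in> cone" "v \<in> cone" "norm (u - ustar) \<le> 2 * \<delta>" "norm (v - ustar) \<le> 2 * \<delta>"
  shows "(norm (\<eta> *\<^sub>R saddle_op u - \<eta> *\<^sub>R saddle_op v))\<^sup>2 \<le> 2 / 3 * (norm (u - v))\<^sup>2"
proof -
  obtain X y l Z w \<mu> where uv: "u = (X, y, l)" "v = (Z, w, \<mu>)" by (metis surj_pair)
  have psd: "X \<in> psd_mats" "Z \<in> psd_mats" "l \<in> nonneg_vecs" using assms by (auto simp: uv cone_def)
  note near = near_ustar[OF assms(3)[unfolded uv]] near_ustar[OF assms(4)[unfolded uv]]
  define p q s where "p = \<eta> * (\<beta> + \<Lambda> * \<beta>g)" and "q = \<eta> * lin_op_norm A" and "s = \<eta> * (sqrt CARD('d) * \<Gamma>)"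
  have "norm (grad_X L X y l - grad_X L Z w \<mu>) \<le>
    (\<beta> + \<Lambda> * \<beta>g) * norm (X - Z) + lin_op_norm A * norm (y - w) + sqrt CARD('d) * \<Gamma> * norm (l - \<mu>)"
    using psd near by (intro norm_grad_X_L_diff \<Lambda> \<Gamma> psd_mats_sym) auto
  then have 1: "norm (\<eta> *\<^sub>R (grad_X L X y l - grad_X L Z w \<mu>)) \<le> p * norm (X - Z) + q * norm (y - w) + s * norm (l - \<mu>)"
    using mult_left_mono[OF _ less_imp_le[OF \<eta>_pos]] \<eta>_pos
    unfolding p_def q_def s_def mult.assoc distrib_left[symmetric] by simp
  have "norm (lin_op A X - lin_op A Z) \<le> lin_op_norm A * norm (X - Z)"
    unfolding lin_op_diff[symmetric]
    using psd by (intro lin_op_norm_bound subspace_diff subspace_sym_mats psd_mats_sym)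
  then have 2: "norm (\<eta> *\<^sub>R (lin_op A X - lin_op A Z)) \<le> q * norm (X - Z)"
    using \<eta>_pos by (simp add: q_def)
  have "norm (g X - g Z) \<le> sqrt CARD('d) * \<Gamma> * norm (X - Z)"
    using psd near by (intro norm_g_diff \<Gamma> psd_mats_sym) auto
  then have 3: "norm (\<eta> *\<^sub>R (g X - g Z)) \<le> s * norm (X - Z)"
    using \<eta>_pos by (simp add: s_def)
  have "\<eta> *\<^sub>R saddle_op u - \<eta> *\<^sub>R saddle_op v = (\<eta> *\<^sub>R (grad_X L X y l - grad_X L Z w \<mu>),
      \<eta> *\<^sub>R (lin_op A X - lin_op A Z), - (\<eta> *\<^sub>R (g X - g Z)))"
    by (simp add: uv scaleR_right_diff_distrib)
  then have "(norm (\<eta> *\<^sub>R saddle_op u - \<eta> *\<^sub>R saddle_op v))\<^sup>2 =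
      (norm (\<eta> *\<^sub>R (grad_X L X y l - grad_X L Z w \<mu>)))\<^sup>2 + (norm (\<eta> *\<^sub>R (lin_op A X - lin_op A Z)))\<^sup>2
      + (norm (\<eta> *\<^sub>R (g X - g Z)))\<^sup>2"
    by (simp only: norm_triple_sq norm_minus_cancel)
  also have "\<dots> \<le> (p * norm (X - Z) + q * norm (y - w) + s * norm (l - \<mu>))\<^sup>2 + (q * norm (X - Z))\<^sup>2
      + (s * norm (X - Z))\<^sup>2"
    by (intro add_mono power_mono 1 2 3 norm_ge_zero)
  also have "\<dots> \<le> 2 / 3 * ((norm (X - Z))\<^sup>2 + (norm (y - w))\<^sup>2 + (norm (l - \<mu>))\<^sup>2)"
  proof (rule saddle_lipschitz_constant)
    have "s\<^sup>2 \<le> (1 / 2)\<^sup>2"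
      using \<eta>_le(2) \<eta>_pos \<Gamma>_nonneg unfolding s_def by (intro power_mono) auto
    then show "s\<^sup>2 \<le> 1 / 4" by (simp add: power2_eq_square)
  qed (use \<eta>_le in \<open>simp add: p_def q_def\<close>)
  also have "\<dots> = 2 / 3 * (norm (u - v))\<^sup>2"
    by (simp add: uv norm_triple_sq)
  finally show ?thesis .
qed

text \<open>The factor 2 rounds up \<open>sqrt 3\<close>, which compares the sum of the three
  component distances with the Euclidean norm.\<close>

lemma grad_X_step_near:
  assumes "u \<in> cone" "norm (u - ustar) \<le> 2 * \<delta>" and m: "\<beta> + \<Lambda> * \<beta>g \<le> m" "lin_op_norm A \<le> m" "sqrt CARD('d) * \<Gamma> \<le> m"
  shows "norm (fst (saddle_op u) - grad_X L Xs ys ls) \<le> 2 * m * norm (u - ustar)"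
proof -
  obtain X y l where u: "u = (X, y, l)" by (metis surj_pair)
  have psd: "X \<in> psd_mats" "l \<in> nonneg_vecs" using assms by (auto simp: u cone_def)
  let ?a = "norm (X - Xs)" and ?b = "norm (y - ys)" and ?c = "norm (l - ls)"
  have "norm (fst (saddle_op u) - grad_X L Xs ys ls) \<le>
    (\<beta> + \<Lambda> * \<beta>g) * ?a + lin_op_norm A * ?b + sqrt CARD('d) * \<Gamma> * ?c"
    using psd near_ustar[OF assms(2)[unfolded u]] \<delta>_nonneg Xs_psd unfolding u saddle_op.simps fst_conv
    by (intro norm_grad_X_L_diff \<Lambda> \<Gamma> psd_mats_sym) auto
  also have "\<dots> \<le> m * ?a + m * ?b + m * ?c"
    using m by (intro add_mono mult_right_mono) auto
  also have "\<dots> = m * (?a + ?b + ?c)" by (simp add: algebra_simps)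
  also have "\<dots> \<le> m * (2 * norm (u - ustar))"
  proof (rule mult_left_mono)
    show "0 \<le> m" using m(2) lin_op_norm_nonneg[of A] by simp
    show "?a + ?b + ?c \<le> 2 * norm (u - ustar)"
    proof (rule power2_le_imp_le)
      have "(?a + ?b + ?c)\<^sup>2 \<le> 3 * (?a\<^sup>2 + ?b\<^sup>2 + ?c\<^sup>2)"
        using zero_le_power2[of "?a - ?b"] zero_le_power2[of "?a - ?c"] zero_le_power2[of "?b - ?c"]
        by (simp add: power2_eq_square algebra_simps)
      also have "\<dots> \<le> 4 * (?a\<^sup>2 + ?b\<^sup>2 + ?c\<^sup>2)" by simp
      also have "\<dots> = (2 * norm (u - ustar))\<^sup>2" by (simp add: u norm_triple_sq power_mult_distrib)
      finally show "(?a + ?b + ?c)\<^sup>2 \<le> (2 * norm (u - ustar))\<^sup>2" .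
    qed simp
  qed
  finally show ?thesis by simp
qed

end

section \<open>Local convergence of the extragradient method\<close>

context smooth_convex_program
begin

lemma proj_point_cone:
  assumes "is_psd_proj (X - \<eta> *\<^sub>R grad_X L Z w \<mu>) X'" "y' = y + \<eta> *\<^sub>R grad_y L Z w \<mu>"
    and "l' = closest_point nonneg_vecs (l + \<eta> *\<^sub>R grad_l L Z w \<mu>)"
  shows "proj_point cone ((X, y, l) - \<eta> *\<^sub>R saddle_op (Z, w, \<mu>)) (X', y', l')"
proof -
  have "(X, y, l) - \<eta> *\<^sub>R saddle_op (Z, w, \<mu>) =
      (X - \<eta> *\<^sub>R grad_X L Z w \<mu>, y', l + \<eta> *\<^sub>R grad_l L Z w \<mu>)"
    by (simp add: assms(2) grad_y_lagrangian grad_l_lagrangian scaleR_right_diff_distrib)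
  moreover have "proj_point psd_mats (X - \<eta> *\<^sub>R grad_X L Z w \<mu>) X'"
    using assms(1) psd_mats_zero unfolding is_psd_proj_def
    by (auto intro!: proj_point_closest_point closed_psd_mats convex_psd_mats)
  moreover have "proj_point nonneg_vecs (l + \<eta> *\<^sub>R grad_l L Z w \<mu>) l'"
    using zero_in_nonneg_vecs unfolding assms(3)
    by (intro proj_point_closest_point closed_nonneg_vecs convex_nonneg_vecs) auto
  moreover have "proj_point UNIV y' y'" by (simp add: proj_point_def)
  ultimately show ?thesis
    unfolding cone_def by (simp only: proj_point_Times)
qed

text \<open>First-order inequalities at the intermediate point; in their weighted sum the linear
  terms cancel.\<close>

lemma L_convex:
  assumes "l \<in> nonneg_vecs"
  shows "convex_on sym_mats (\<lambda>X. L X y l)"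
proof (rule convex_onI)
  fix t :: real and X Y :: "real^'n^'n" assume t: "0 < t" "t < 1" and XY: "X \<in> sym_mats" "Y \<in> sym_mats"
  let ?V = "(1 - t) *\<^sub>R X + t *\<^sub>R Y"
  have V: "?V \<in> sym_mats" using XY by (intro subspace_add subspace_scale subspace_sym_mats)
  have "(1 - t) * (grad_X L ?V y l \<bullet> (X - ?V)) + t * (grad_X L ?V y l \<bullet> (Y - ?V))
      \<le> (1 - t) * (L X y l - L ?V y l) + t * (L Y y l - L ?V y l)"
    using t XY V assms by (intro add_mono mult_left_mono grad_X_L_ineq) auto
  moreover have "(1 - t) * (grad_X L ?V y l \<bullet> (X - ?V)) + t * (grad_X L ?V y l \<bullet> (Y - ?V)) = 0"
    by (simp add: inner_add_right inner_diff_right algebra_simps)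
  ultimately show "L ?V y l \<le> (1 - t) * L X y l + t * L Y y l"
    by (simp add: algebra_simps)
qed (rule subspace_imp_convex[OF subspace_sym_mats])

end

text \<open>The reason for the radii of \<open>C_y\<close> and \<open>C_l\<close>: the dual test
  points overshoot \<open>ys\<close> or \<open>ls\<close> so far that, after subtracting the saddle
  inequality \<open>f Xs \<le> L X ys ls\<close>, one copy of the violation survives.\<close>

lemma (in local_saddle_point) bounds_of_gap:
  fixes X :: "real^'n^'n" and \<epsilon> :: real
  assumes X: "X \<in> psd_mats"
    and gap: "\<And>y l. norm y \<le> 2 * norm ys \<Longrightarrow> l \<in> nonneg_vecs \<Longrightarrow> norm l \<le> norm ls + sqrt CARD('d) \<Longrightarrow> L X y l - f Xs \<le> \<epsilon>"
  shows "f X - f Xs \<le> \<epsilon>" "norm ys * norm (lin_op A X - b) \<le> \<epsilon>"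
    "(\<Sum>i | g X $ i > 0. g X $ i) \<le> \<epsilon>"
proof -
  show "f X - f Xs \<le> \<epsilon>"
    using gap[of 0 0] zero_in_nonneg_vecs by (simp add: lagrangian_def)
  define h where "h = lin_op A X - b"
  have ge: "f Xs \<le> f X + ls \<bullet> g X - ys \<bullet> h"
    using L_ge[OF X] by (simp add: lagrangian_def h_def inner_diff_right)
  \<comment> \<open>Opposite to the residual \<open>h\<close>, with norm \<open>2 * norm ys\<close>:
    one copy of \<open>norm ys\<close> pays for \<open>ys \<bullet> h\<close>, the other remains.
    For \<open>h = 0\<close> the coefficient is 0, since division by zero yields 0.\<close>
  have "norm (- (2 * norm ys / norm h) *\<^sub>R h) \<le> 2 * norm ys" by simp
  then have "L X (- (2 * norm ys / norm h) *\<^sub>R h) ls - f Xs \<le> \<epsilon>"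
    using ls_nonneg by (intro gap) auto
  moreover have "L X (- (2 * norm ys / norm h) *\<^sub>R h) ls = f X + ls \<bullet> g X + 2 * (norm ys * norm h)"
  proof -
    have "b - lin_op A X = - h" by (simp add: h_def)
    then show ?thesis
      by (simp add: lagrangian_def power2_norm_eq_inner[symmetric] power2_eq_square)
  qed
  ultimately show "norm ys * norm (lin_op A X - b) \<le> \<epsilon>"
    using ge norm_cauchy_schwarz[of "- ys" h] unfolding h_def[symmetric] by simp
  define k :: "real^'d" where "k = (\<chi> i. if g X $ i > 0 then 1 else 0)"
  have k: "k \<in> nonneg_vecs" "norm k \<le> sqrt CARD('d)"
    using norm_le_sqrt_card[of k 1] by (auto simp: k_def nonneg_vecs_def)
  have "L X ys (ls + k) - f Xs \<le> \<epsilon>"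
    using k ls_nonneg norm_triangle_ineq[of ls k] by (intro gap nonneg_vecs_add) auto
  moreover have "k \<bullet> g X = (\<Sum>i | g X $ i > 0. g X $ i)"
    by (simp only: k_def inner_indicator)
  ultimately show "(\<Sum>i | g X $ i > 0. g X $ i) \<le> \<epsilon>"
    using ge by (simp add: lagrangian_def h_def inner_add_left inner_diff_right)
qed

section \<open>The method started near the saddle point\<close>

locale local_extragradient = local_saddle_point f g A b \<beta> \<beta>g Xs ys ls \<delta> \<Lambda> \<Gamma> \<eta>
  for f :: "real^'n^'n \<Rightarrow> real" and g :: "real^'n^'n \<Rightarrow> real^'d"
    and A :: "'m::finite \<Rightarrow> real^'n^'n" and b :: "real^'m" and \<beta> \<beta>g :: real
    and Xs ys ls \<delta> \<Lambda> \<Gamma> \<eta> +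
  fixes X Z :: "nat \<Rightarrow> real^'n^'n" and y w :: "nat \<Rightarrow> real^'m" and l \<mu> :: "nat \<Rightarrow> real^'d"
  assumes EG: "extragradient is_psd_proj L \<eta> X y l Z w \<mu>"
    and init: "norm ((X 1, y 1, l 1) - ustar) \<le> \<delta>"
begin

abbreviation u where "u t \<equiv> (X t, y t, l t)"
abbreviation z where "z t \<equiv> (Z t, w t, \<mu> t)"
abbreviation D where "D \<equiv> norm (u 1 - ustar)"

sublocale eg: eg_iteration cone "\<lambda>u. \<eta> *\<^sub>R saddle_op u" ustar \<delta> u z
proof
  show "0 \<le> (\<eta> *\<^sub>R saddle_op x - \<eta> *\<^sub>R saddle_op y) \<bullet> (x - y)" if "x \<in> cone" "y \<in> cone" for x y
    using saddle_op_mono[OF that] \<eta>_pos by (simp flip: scaleR_right_diff_distrib)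
  show "ustar \<in> cone" by (simp add: cone_def Xs_psd ls_nonneg)
  show "0 \<le> (\<eta> *\<^sub>R saddle_op ustar) \<bullet> (v - ustar)" if "v \<in> cone" for v
    using saddle_op_solution[OF that] \<eta>_pos by (simp del: saddle_op.simps)
  show "u 1 \<in> cone" using EG by (simp add: cone_def extragradient_def)
  show "norm (u 1 - ustar) \<le> \<delta>" by (rule init)
  fix t :: nat assume t: "t \<ge> 1"
  show "proj_point cone (u t - \<eta> *\<^sub>R saddle_op (u t)) (z (Suc t))"
    using EG t unfolding extragradient_def by (intro proj_point_cone) auto
  show "proj_point cone (u t - \<eta> *\<^sub>R saddle_op (z (Suc t))) (u (Suc t))"
    using EG t unfolding extragradient_def by (intro proj_point_cone) auto
qed (rule saddle_op_lipschitz)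

lemma X_psd: "t \<ge> 1 \<Longrightarrow> X t \<in> psd_mats"
  using eg.u_mem by (simp add: cone_def)

lemma z_psd: "t \<ge> 1 \<Longrightarrow> Z (Suc t) \<in> psd_mats" "t \<ge> 1 \<Longrightarrow> \<mu> (Suc t) \<in> nonneg_vecs"
  using eg.z_mem by (simp_all add: cone_def)

text \<open>The comparison point has primal part \<open>Xs\<close> and free dual part; feasibility
  of \<open>Xs\<close> gives \<open>L Xs w \<mu> \<le> f Xs\<close> for all multipliers met on the
  way. Jensen's inequality passes to the average.\<close>

lemma ergodic_gap:
  assumes T: "T \<ge> 1" and k: "k \<in> nonneg_vecs"
  shows "L ((1 / real T) *\<^sub>R (\<Sum>t=1..T. Z (t + 1))) v k - f Xs
    \<le> ((norm (X 1 - Xs))\<^sup>2 + (norm (y 1 - v))\<^sup>2 + (norm (l 1 - k))\<^sup>2) / (2 * \<eta> * real T)"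
proof -
  let ?p = "(Xs, v, k)"
  have "\<eta> * (L (Z (Suc t)) v k - f Xs) \<le> (\<eta> *\<^sub>R saddle_op (z (Suc t))) \<bullet> (z (Suc t) - ?p)"
    if t: "t \<in> {1..T}" for t
  proof -
    have "L Xs (w (Suc t)) (\<mu> (Suc t)) \<le> f Xs"
      using inner_g_Xs_le[OF z_psd(2)] t by (simp add: L_Xs)
    moreover have "L (Z (Suc t)) v k - L Xs (w (Suc t)) (\<mu> (Suc t)) \<le> saddle_op (z (Suc t)) \<bullet> (z (Suc t) - ?p)"
      using t z_psd by (intro saddle_op_gap Xs_sym psd_mats_sym) auto
    ultimately have "\<eta> * (L (Z (Suc t)) v k - f Xs) \<le> \<eta> * (saddle_op (z (Suc t)) \<bullet> (z (Suc t) - ?p))"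
      using \<eta>_pos by (intro mult_left_mono) auto
    then show ?thesis by (simp only: inner_scaleR_left)
  qed
  then have "(\<Sum>t=1..T. \<eta> * (L (Z (Suc t)) v k - f Xs)) \<le> (\<Sum>t=1..T. (\<eta> *\<^sub>R saddle_op (z (Suc t))) \<bullet> (z (Suc t) - ?p))"
    by (rule sum_mono)
  also have "\<dots> \<le> (norm (u 1 - ?p))\<^sup>2 / 2"
    using k by (intro eg.sum_gap_le) (simp add: cone_def Xs_psd)
  finally have 1: "\<eta> * ((\<Sum>t=1..T. L (Z (Suc t)) v k) - real T * f Xs) \<le> (norm (u 1 - ?p))\<^sup>2 / 2"
    unfolding sum_distrib_left[symmetric] by (simp add: sum_subtractf)
  have "L (\<Sum>t\<in>{1..T}. (1 / real T) *\<^sub>R Z (Suc t)) v k \<le> (\<Sum>t\<in>{1..T}. (1 / real T) * L (Z (Suc t)) v k)"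
    using T z_psd by (intro convex_on_sum[OF _ _ L_convex[OF k]]) (auto intro: psd_mats_sym)
  then have "real T * L ((1 / real T) *\<^sub>R (\<Sum>t=1..T. Z (t + 1))) v k \<le> (\<Sum>t=1..T. L (Z (Suc t)) v k)"
    using T by (simp add: scaleR_right.sum sum_divide_distrib[symmetric] field_simps)
  then have "\<eta> * (real T * L ((1 / real T) *\<^sub>R (\<Sum>t=1..T. Z (t + 1))) v k - real T * f Xs)
      \<le> \<eta> * ((\<Sum>t=1..T. L (Z (Suc t)) v k) - real T * f Xs)"
    using \<eta>_pos by (intro mult_left_mono) auto
  also note 1
  finally have "2 * \<eta> * real T * (L ((1 / real T) *\<^sub>R (\<Sum>t=1..T. Z (t + 1))) v k - f Xs) \<le> (norm (u 1 - ?p))\<^sup>2"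
    by (simp add: algebra_simps)
  then show ?thesis
    using T \<eta>_pos by (simp add: norm_triple_sq field_simps)
qed

lemma average_psd: "(1 / real T) *\<^sub>R (\<Sum>t=1..T. Z (t + 1)) \<in> psd_mats"
  using z_psd by (intro psd_mats_scale psd_mats_sum) auto

text \<open>Bound for the gap of the last iterate per unit of distance to the test point;
  \<open>2 * sqrt 2\<close> rounds up \<open>sqrt (65 / 9)\<close>.\<close>

definition \<epsilon> :: "nat \<Rightarrow> real" where
  "\<epsilon> T = 2 * sqrt 2 * D / (\<eta> * sqrt (real T))"

lemma \<epsilon>_nonneg: "0 \<le> \<epsilon> T"
  using \<eta>_pos by (simp add: \<epsilon>_def)

lemma last_iterate_gap_bound:
  assumes T: "T \<ge> 1" and v: "v \<in> cone"
  shows "saddle_op (z (Suc T)) \<bullet> (z (Suc T) - v) \<le> \<epsilon> T * norm (z (Suc T) - v)"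
proof -
  have "sqrt (65 / 9) \<le> sqrt 8" by (rule real_sqrt_le_mono) simp
  also have "sqrt 8 = 2 * sqrt 2" using real_sqrt_mult[of 4 2] by simp
  finally have "sqrt (65 / 9) * D / sqrt T \<le> 2 * sqrt 2 * D / sqrt T"
    by (intro divide_right_mono mult_right_mono) auto
  also have "\<dots> = \<eta> * \<epsilon> T" using \<eta>_pos by (simp add: \<epsilon>_def)
  finally have "sqrt (65 / 9) * D / sqrt T * norm (z (Suc T) - v) \<le> \<eta> * \<epsilon> T * norm (z (Suc T) - v)"
    by (rule mult_right_mono) simp
  with eg.last_iterate_gap[OF T v]
  have "\<eta> * (saddle_op (z (Suc T)) \<bullet> (z (Suc T) - v)) \<le> \<eta> * (\<epsilon> T * norm (z (Suc T) - v))"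
    unfolding inner_scaleR_left mult.assoc by (rule order_trans)
  then show ?thesis using \<eta>_pos by simp
qed

text \<open>The test point \<open>(Xs, 0, 0)\<close> strips the dual terms from the Lagrangian; its
  distance to the iterate brings in the norms of \<open>ys\<close> and \<open>ls\<close>.\<close>

lemma last_iterate_f:
  assumes T: "T \<ge> 1"
  shows "f (Z (Suc T)) - f Xs \<le> \<epsilon> T * (2 * D + sqrt ((norm ys)\<^sup>2 + (norm ls)\<^sup>2))"
proof -
  have "f (Z (Suc T)) - f Xs \<le> L (Z (Suc T)) 0 0 - L Xs (w (Suc T)) (\<mu> (Suc T))"
    using inner_g_Xs_le[OF z_psd(2)] T by (simp add: L_Xs) (simp add: lagrangian_def)
  also have "\<dots> \<le> saddle_op (z (Suc T)) \<bullet> (z (Suc T) - (Xs, 0, 0))"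
    using T z_psd by (intro saddle_op_gap Xs_sym psd_mats_sym) auto
  also have "\<dots> \<le> \<epsilon> T * norm (z (Suc T) - (Xs, 0, 0))"
    using T by (intro last_iterate_gap_bound) (simp_all add: cone_def Xs_psd zero_in_nonneg_vecs)
  also have "\<dots> \<le> \<epsilon> T * (2 * D + sqrt ((norm ys)\<^sup>2 + (norm ls)\<^sup>2))"
  proof (rule mult_left_mono[OF _ \<epsilon>_nonneg])
    have "norm (z (Suc T) - (Xs, 0, 0)) \<le> norm (z (Suc T) - ustar) + norm (ustar - (Xs, 0, 0))"
      using norm_triangle_ineq[of "z (Suc T) - ustar" "ustar - (Xs, 0, 0)"] by simp
    moreover have "norm (ustar - (Xs, 0, 0)) = sqrt ((norm ys)\<^sup>2 + (norm ls)\<^sup>2)"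
      by (simp add: norm_Pair)
    ultimately show "norm (z (Suc T) - (Xs, 0, 0)) \<le> 2 * D + sqrt ((norm ys)\<^sup>2 + (norm ls)\<^sup>2)"
      using eg.z_near_init[OF T] by linarith
  qed
  finally show ?thesis .
qed

text \<open>The test point differs from the iterate only in the dual vector, by the residual itself,
  so the gap is the squared residual and one factor cancels.\<close>

lemma last_iterate_lin_op:
  assumes T: "T \<ge> 1"
  shows "norm (lin_op A (Z (Suc T)) - b) \<le> \<epsilon> T"
proof -
  let ?h = "lin_op A (Z (Suc T)) - b"
  have "saddle_op (z (Suc T)) \<bullet> (z (Suc T) - (Z (Suc T), w (Suc T) - ?h, \<mu> (Suc T)))
      \<le> \<epsilon> T * norm (z (Suc T) - (Z (Suc T), w (Suc T) - ?h, \<mu> (Suc T)))"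
    using T z_psd by (intro last_iterate_gap_bound) (simp_all add: cone_def)
  then have "norm ?h * norm ?h \<le> \<epsilon> T * norm ?h"
    by (simp add: norm_Pair power2_norm_eq_inner[symmetric] power2_eq_square)
  then show ?thesis using \<epsilon>_nonneg by (cases "?h = 0") auto
qed

text \<open>Only the multipliers are shifted, by the indicator of the violated constraints, so the
  gap is exactly the total violation.\<close>

lemma last_iterate_g:
  assumes T: "T \<ge> 1"
  shows "(\<Sum>i | g (Z (Suc T)) $ i > 0. g (Z (Suc T)) $ i) \<le> \<epsilon> T * sqrt CARD('d)"
proof -
  define k :: "real^'d" where "k = (\<chi> i. if g (Z (Suc T)) $ i > 0 then 1 else 0)"
  have k: "k \<in> nonneg_vecs" "norm k \<le> sqrt CARD('d)"
    using norm_le_sqrt_card[of k 1] by (auto simp: k_def nonneg_vecs_def)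
  have "(\<Sum>i | g (Z (Suc T)) $ i > 0. g (Z (Suc T)) $ i) = k \<bullet> g (Z (Suc T))"
    by (simp only: k_def inner_indicator)
  also have "\<dots> = saddle_op (z (Suc T)) \<bullet> (z (Suc T) - (Z (Suc T), w (Suc T), \<mu> (Suc T) + k))"
    by (simp add: inner_commute)
  also have "\<dots> \<le> \<epsilon> T * norm (z (Suc T) - (Z (Suc T), w (Suc T), \<mu> (Suc T) + k))"
    using T z_psd k by (intro last_iterate_gap_bound) (simp_all add: cone_def nonneg_vecs_add)
  also have "\<dots> = \<epsilon> T * norm k" by (simp add: norm_Pair)
  also have "\<dots> \<le> \<epsilon> T * sqrt CARD('d)" using k \<epsilon>_nonneg by (intro mult_left_mono)
  finally show ?thesis .
qed

text \<open>Both projections of a step start from \<open>X t\<close>, within \<open>D\<close> of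
  \<open>Xs\<close>; the gradient is taken within \<open>2 * D\<close> of the saddle point and
  contributes at most \<open>4 * \<eta> * m * D\<close>. The fraction in \<open>R0\<close> is
  designed to keep the sum below \<open>\<eta> * \<delta>\<close>.\<close>

lemma step_eigval_nonpos:
  assumes t: "t \<ge> 1" and v: "v = u t \<or> v = z (Suc t)"
    and m: "\<beta> + \<Lambda> * \<beta>g \<le> m" "lin_op_norm A \<le> m" "sqrt CARD('d) * \<Gamma> \<le> m"
    and D: "2 * D * (1 + 2 * \<eta> * m) \<le> \<eta> * \<delta>"
    and r: "r < CARD('n)" and k: "1 \<le> k" "CARD('n) - r + k - 1 \<le> CARD('n)"
    and pos: "0 < \<delta>" and \<delta>: "\<delta> = sqrt k * eigval (grad_X L Xs ys ls) (CARD('n) - r + k - 1)"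
  shows "eigval (X t - \<eta> *\<^sub>R fst (saddle_op v)) (r + 1) \<le> 0"
proof (rule eigval_nonpos_of_perturbation[OF _ Xs_psd GL_psd Xs_GL r k _ \<eta>_pos])
  have vc: "v \<in> cone" using v eg.u_mem[OF t] eg.z_mem[OF t] by auto
  have vn: "norm (v - ustar) \<le> 2 * D"
    using v
  proof
    assume "v = u t"
    show ?thesis
      unfolding \<open>v = u t\<close> using eg.u_near[OF t] norm_ge_zero[of "u 1 - ustar"] by linarith
  next
    assume "v = z (Suc t)"
    then show ?thesis using eg.z_near_init[OF t] by simp
  qed
  have m0: "0 \<le> m" using m(2) lin_op_norm_nonneg[of A] by simp
  have "fst (saddle_op v) \<in> sym_mats"
    using vc by (cases v) (auto simp: cone_def intro: grad_X_L_sym psd_mats_sym)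
  then show "X t - \<eta> *\<^sub>R fst (saddle_op v) \<in> sym_mats"
    using psd_mats_sym[OF X_psd[OF t]] by (intro subspace_diff subspace_scale subspace_sym_mats)
  show "0 < eigval (grad_X L Xs ys ls) (CARD('n) - r + k - 1)"
    using pos k unfolding \<delta> by (simp add: zero_less_mult_iff)
  let ?G = "fst (saddle_op v) - grad_X L Xs ys ls"
  have "norm ?G \<le> 2 * m * norm (v - ustar)"
    using vc vn init m by (intro grad_X_step_near) auto
  also have "\<dots> \<le> 2 * m * (2 * D)" using vn m0 by (intro mult_left_mono) auto
  finally have G: "\<eta> * norm ?G \<le> \<eta> * (2 * m * (2 * D))" using \<eta>_pos by (intro mult_left_mono) auto
  have "norm (X t - Xs) \<le> D"
    using eg.u_near[OF t] norm_le_norm_triple(1)[where a = "X t - Xs" and b = "y t - ys" and c = "l t - ls"]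
    by simp
  moreover have diff: "X t - \<eta> *\<^sub>R fst (saddle_op v) - (Xs - \<eta> *\<^sub>R grad_X L Xs ys ls) = (X t - Xs) - \<eta> *\<^sub>R ?G"
    by (simp add: scaleR_right_diff_distrib)
  moreover have "norm ((X t - Xs) - \<eta> *\<^sub>R ?G) \<le> norm (X t - Xs) + \<eta> * norm ?G"
    using norm_triangle_ineq4[of "X t - Xs" "\<eta> *\<^sub>R ?G"] \<eta>_pos by simp
  ultimately have "norm (X t - \<eta> *\<^sub>R fst (saddle_op v) - (Xs - \<eta> *\<^sub>R grad_X L Xs ys ls)) \<le> D + \<eta> * (2 * m * (2 * D))"
    using G unfolding diff by linarith
  also have "\<dots> \<le> 2 * D * (1 + 2 * \<eta> * m)"
    using norm_ge_zero[of "u 1 - ustar"] by (simp only: algebra_simps)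
  also note D
  finally show "norm (X t - \<eta> *\<^sub>R fst (saddle_op v) - (Xs - \<eta> *\<^sub>R grad_X L Xs ys ls))
      \<le> \<eta> * (sqrt k * eigval (grad_X L Xs ys ls) (CARD('n) - r + k - 1))"
    unfolding \<delta> .
qed

text \<open>Truncation being a relation, a second truncated run from the same start has to be
  excluded. By induction its inputs agree with those of the given run, where truncation is
  single-valued.\<close>

lemma extragradient_trunc_proj:
  assumes trunc: "\<And>t v P. t \<ge> 1 \<Longrightarrow> v = u t \<or> v = z (Suc t) \<Longrightarrow>
    is_trunc_proj r (X t - \<eta> *\<^sub>R fst (saddle_op v)) P \<longleftrightarrow> is_psd_proj (X t - \<eta> *\<^sub>R fst (saddle_op v)) P"
  shows "extragradient (is_trunc_proj r) L \<eta> X y l Z w \<mu>"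
    and "extragradient (is_trunc_proj r) L \<eta> X' y' l' Z' w' \<mu>' \<Longrightarrow> X' 1 = X 1 \<Longrightarrow> y' 1 = y 1 \<Longrightarrow> l' 1 = l 1 \<Longrightarrow>
      (\<forall>t\<ge>1. X' t = X t \<and> y' t = y t \<and> l' t = l t) \<and> (\<forall>t\<ge>2. Z' t = Z t \<and> w' t = w t \<and> \<mu>' t = \<mu> t)"
proof -
  have tr: "is_trunc_proj r (X t - \<eta> *\<^sub>R grad_X L (X t) (y t) (l t)) P
      \<longleftrightarrow> is_psd_proj (X t - \<eta> *\<^sub>R grad_X L (X t) (y t) (l t)) P"
    "is_trunc_proj r (X t - \<eta> *\<^sub>R grad_X L (Z (t + 1)) (w (t + 1)) (\<mu> (t + 1))) P
      \<longleftrightarrow> is_psd_proj (X t - \<eta> *\<^sub>R grad_X L (Z (t + 1)) (w (t + 1)) (\<mu> (t + 1))) P"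
    if "t \<ge> 1" for t P
    using trunc[OF that, of "u t" P] trunc[OF that, of "z (Suc t)" P] by simp_all
  show "extragradient (is_trunc_proj r) L \<eta> X y l Z w \<mu>"
    using EG tr unfolding extragradient_def by blast
  assume EG': "extragradient (is_trunc_proj r) L \<eta> X' y' l' Z' w' \<mu>'"
    and eq1: "X' 1 = X 1" "y' 1 = y 1" "l' 1 = l 1"
  note E = EG[unfolded extragradient_def, THEN conjunct2, THEN conjunct2, rule_format]
  note E' = EG'[unfolded extragradient_def, THEN conjunct2, THEN conjunct2, rule_format]
  have one_step: "Z' (t + 1) = Z (t + 1) \<and> w' (t + 1) = w (t + 1) \<and> \<mu>' (t + 1) = \<mu> (t + 1)
      \<and> X' (t + 1) = X (t + 1) \<and> y' (t + 1) = y (t + 1) \<and> l' (t + 1) = l (t + 1)"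
    if t: "t \<ge> 1" and eq: "X' t = X t" "y' t = y t" "l' t = l t" for t
  proof -
    have zeq: "Z' (t + 1) = Z (t + 1)" "w' (t + 1) = w (t + 1)" "\<mu>' (t + 1) = \<mu> (t + 1)"
      using E[OF t] E'[OF t] unfolding eq tr(1)[OF t] is_psd_proj_def by metis+
    moreover have "X' (t + 1) = X (t + 1)" "y' (t + 1) = y (t + 1)" "l' (t + 1) = l (t + 1)"
      using E[OF t] E'[OF t] unfolding eq zeq tr(2)[OF t] is_psd_proj_def by metis+
    ultimately show ?thesis by blast
  qed
  have ueq: "X' t = X t \<and> y' t = y t \<and> l' t = l t" if "t \<ge> 1" for t
    using that
  proof (induction t rule: dec_induct)
    case (step t)
    then show ?case using one_step[of t] by simp
  qed (use eq1 in simp)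
  moreover have "Z' t = Z t \<and> w' t = w t \<and> \<mu>' t = \<mu> t" if "t \<ge> 2" for t
    using one_step[of "t - 1"] ueq[of "t - 1"] that by simp
  ultimately show "(\<forall>t\<ge>1. X' t = X t \<and> y' t = y t \<and> l' t = l t) \<and> (\<forall>t\<ge>2. Z' t = Z t \<and> w' t = w t \<and> \<mu>' t = \<mu> t)"
    by blast
qed

end

text \<open>In the extended reals \<open>1 / 0\<close> is infinite, so a zero denominator imposes no
  constraint and the claim becomes \<open>0 \<le> 1\<close>.\<close>

lemma le_inverse_ereal:
  assumes "ereal \<eta> \<le> 1 / ereal x" "0 \<le> x"
  shows "\<eta> * x \<le> 1"
  using assms by (cases "x = 0") (auto simp: divide_simps one_ereal_def mult.commute)

lemma bdd_above_norm_sq: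
  fixes a :: "'a::real_normed_vector"
  assumes "\<And>x. x \<in> C \<Longrightarrow> norm x \<le> B"
  shows "bdd_above ((\<lambda>x. (norm (a - x))\<^sup>2) ` C)"
proof (rule bdd_aboveI2)
  fix x assume "x \<in> C"
  then show "(norm (a - x))\<^sup>2 \<le> (norm a + B)\<^sup>2"
    using assms norm_triangle_ineq4[of a x] by (intro power_mono) (auto intro: order_trans)
qed

lemma scaled_squares_le:
  fixes \<eta> a b c :: real
  assumes "\<eta> * (2 * sqrt (a\<^sup>2 + b\<^sup>2 + c\<^sup>2)) \<le> 1" "0 \<le> \<eta>"
  shows "(\<eta> * a)\<^sup>2 + (\<eta> * b)\<^sup>2 \<le> 1 / 4"
proof -
  have "(\<eta> * (2 * sqrt (a\<^sup>2 + b\<^sup>2 + c\<^sup>2)))\<^sup>2 \<le> 1\<^sup>2"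
    using assms by (intro power_mono) auto
  then have "4 * ((\<eta> * a)\<^sup>2 + (\<eta> * b)\<^sup>2 + (\<eta> * c)\<^sup>2) \<le> 1"
    by (simp add: power_mult_distrib algebra_simps)
  then show ?thesis using zero_le_power2[of "\<eta> * c"] by argo
qed

theorem theorem5p2:
  fixes f :: "real^'n^'n \<Rightarrow> real" and g :: "real^'n^'n \<Rightarrow> real^'d"
    and A :: "'m::finite \<Rightarrow> real^'n^'n" and b :: "real^'m"
    and \<beta> \<beta>g \<eta> :: real and r rt :: nat
    and XS Xs :: "real^'n^'n" and ys :: "real^'m" and ls :: "real^'d"
    and L :: "real^'n^'n \<Rightarrow> real^'m \<Rightarrow> real^'d \<Rightarrow> real" and GL :: "real^'n^'n"
    and \<delta> \<Lambda> \<Gamma> R0 Rsq R1 :: real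
    and D_X :: "(real^'n^'n) set" and D_l C_l :: "(real^'d) set" and C_y :: "(real^'m) set"
    and X Z :: "nat \<Rightarrow> real^'n^'n" and y w :: "nat \<Rightarrow> real^'m" and l \<mu> :: "nat \<Rightarrow> real^'d"
    and Xbar :: "nat \<Rightarrow> real^'n^'n"
  assumes A_sym: "\<And>i. A i \<in> sym_mats"
    and f_convex: "convex_on sym_mats f"
    and f_smooth: "smooth_on sym_mats \<beta> f"
    and g_convex: "\<And>i. convex_on sym_mats (\<lambda>X. g X $ i)"
    and g_smooth: "\<And>i. smooth_on sym_mats \<beta>g (\<lambda>X. g X $ i)"
    and slater: "XS \<in> pd_mats" "\<And>i. g XS $ i < 0" "lin_op A XS = b"
    and bounded_below: "bdd_below (f ` feasible g A b)"
    and Xs_opt: "optimal_solution f g A b Xs"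
    and L_eq: "L = lagrangian f g A b"
    and dual: "dual_solution L Xs ys ls"
    and GL_eq: "GL = grad_X L Xs ys ls"
    and rt_eq: "rt = CARD('n) - rank GL"
    and r_ge: "rt \<le> r"
    and indices: "CARD('n) - r \<in> {1..CARD('n)}" "CARD('n) - r + rt - 1 \<in> {1..CARD('n)}"
    and \<delta>_eq: "\<delta> = max (eigval GL (CARD('n) - r)) (sqrt rt * eigval GL (CARD('n) - r + rt - 1))"
    and D_X_eq: "D_X = {X \<in> psd_mats. norm (X - Xs) \<le> 2 * \<delta>}"
    and D_l_eq: "D_l = {l \<in> nonneg_vecs. norm (l - ls) \<le> 2 * \<delta>}"
    and \<Lambda>_eq: "\<Lambda> = (SUP l\<in>D_l. \<Sum>i\<in>UNIV. \<bar>l $ i\<bar>)"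
    and \<Gamma>_eq: "\<Gamma> = (SUP X\<in>D_X. MAX i. norm (gradient sym_mats (\<lambda>X. g X $ i) X))"
    and \<eta>_pos: "0 < \<eta>"
    and \<eta>_le: "ereal \<eta> \<le> Min
      {1 / ereal (2 * sqrt ((\<beta> + \<Lambda> * \<beta>g)\<^sup>2 + (lin_op_norm A)\<^sup>2 + \<beta>g\<^sup>2)),
       1 / ereal (2 * max (lin_op_norm A) (sqrt CARD('d) * \<Gamma>)),
       1 / ereal (\<beta> + \<Lambda> * \<beta>g + sqrt 2 * max (lin_op_norm A) \<Gamma>)}"
    and EG: "extragradient is_psd_proj L \<eta> X y l Z w \<mu>"
    and R0_eq: "R0 = \<delta> * min 1 (((1/2) * \<eta>) /
      (1 + 2 * \<eta> * Max {\<beta> + \<Lambda> * \<beta>g, lin_op_norm A, sqrt CARD('d) * \<Gamma>}))"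
    and init: "norm ((X 1, y 1, l 1) - (Xs, ys, ls)) \<le> R0"
    and C_y_eq: "C_y = {y. norm y \<le> 2 * norm ys}"
    and C_l_eq: "C_l = {l \<in> nonneg_vecs. norm l \<le> norm ls + sqrt CARD('d)}"
    and Rsq_eq: "Rsq = (norm (X 1 - Xs))\<^sup>2 + (SUP y'\<in>C_y. (norm (y 1 - y'))\<^sup>2)
      + (SUP l'\<in>C_l. (norm (l 1 - l'))\<^sup>2)"
    and R1_eq: "R1 = 3 * sqrt 2 *
      Max {2 * R0, 3 * sqrt 2 * norm ys, sqrt 2 * (2 * norm ls + sqrt CARD('d))} *
      norm ((X 1, y 1, l 1) - (Xs, ys, ls))"
    and Xbar_eq: "\<And>T. Xbar T = (1 / real T) *\<^sub>R (\<Sum>t=1..T. Z (t + 1))"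
  shows
    "extragradient (is_trunc_proj r) L \<eta> X y l Z w \<mu> \<and>
     (\<forall>X' y' l' Z' w' \<mu>'.
        extragradient (is_trunc_proj r) L \<eta> X' y' l' Z' w' \<mu>' \<and> X' 1 = X 1 \<and> y' 1 = y 1 \<and> l' 1 = l 1 \<longrightarrow>
        (\<forall>t\<ge>1. X' t = X t \<and> y' t = y t \<and> l' t = l t) \<and>
        (\<forall>t\<ge>2. Z' t = Z t \<and> w' t = w t \<and> \<mu>' t = \<mu> t)) \<and>
     (\<forall>T\<ge>1.
        f (Xbar T) - f Xs \<le> Rsq / (2 * \<eta> * real T) \<and>
        (ys \<noteq> 0 \<longrightarrow> norm (lin_op A (Xbar T) - b) \<le> Rsq / (2 * norm ys * \<eta> * real T)) \<and>
        (\<Sum>i | g (Xbar T) $ i > 0. g (Xbar T) $ i) \<le> Rsq / (2 * \<eta> * real T)) \<and>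
     (\<forall>T\<ge>1.
        f (Z (T + 1)) - f Xs \<le> R1 / (\<eta> * sqrt (real T)) \<and>
        (ys \<noteq> 0 \<longrightarrow> norm (lin_op A (Z (T + 1)) - b) \<le> R1 / (norm ys * \<eta> * sqrt (real T))) \<and>
        (\<Sum>i | g (Z (T + 1)) $ i > 0. g (Z (T + 1)) $ i) \<le> R1 / (\<eta> * sqrt (real T)))"
proof -
  interpret smooth_convex_program f g A b \<beta> \<beta>g
    using A_sym f_convex f_smooth g_convex g_smooth by unfold_locales
  note L_eq[simp]
  let ?bX = "\<beta> + \<Lambda> * \<beta>g" and ?N = "lin_op_norm A" and ?s = "sqrt CARD('d) * \<Gamma>"
  let ?n = "CARD('n)"
  define m where "m = Max {?bX, ?N, ?s}"
  define D where "D = norm ((X 1, y 1, l 1) - (Xs, ys, ls))"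
  have m: "?bX \<le> m" "?N \<le> m" "?s \<le> m" by (simp_all add: m_def)
  have m0: "0 \<le> m" using m(2) lin_op_norm_nonneg[of A] by linarith
  define c where "c = 1 + 2 * \<eta> * m"
  define q where "q = ((1/2) * \<eta>) / c"
  have den: "0 < c" using m0 \<eta>_pos by (simp add: c_def add_pos_nonneg)
  have q: "0 < q" using den \<eta>_pos by (simp add: q_def)
  have R0: "R0 = \<delta> * min 1 q" by (simp add: R0_eq q_def c_def m_def)
  have DR: "D \<le> R0" using init by (simp add: D_def)
  have D0: "0 \<le> D" by (simp add: D_def)
  \<comment> \<open>Forced by the initialization: a distance is at most \<open>\<delta>\<close>
    times a positive number.\<close>
  have \<delta>0: "0 \<le> \<delta>"
    using order_trans[OF D0 DR] q unfolding R0 zero_le_mult_iff by linarith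
  have D\<delta>: "D \<le> \<delta>"
    using DR mult_left_mono[OF min.cobounded1[of 1 q] \<delta>0] by (simp add: R0)
  have Dq: "2 * D * c \<le> \<eta> * \<delta>"
  proof -
    have "D \<le> \<delta> * q" using DR mult_left_mono[OF min.cobounded2[of 1 q] \<delta>0] by (simp add: R0)
    then have "D * c \<le> \<delta> * q * c"
      using den by (intro mult_right_mono) auto
    also have "\<dots> = \<delta> * (\<eta> / 2)" using den by (simp add: q_def)
    finally show ?thesis by (simp add: mult.assoc mult.commute[of \<eta>])
  qed
  have \<Lambda>': "(\<Sum>i\<in>UNIV. \<bar>k $ i\<bar>) \<le> \<Lambda>" if "k \<in> nonneg_vecs" "norm (k - ls) \<le> 2 * \<delta>" for k
    unfolding \<Lambda>_eq
  proof (rule cSUP_upper)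
    show "bdd_above ((\<lambda>l. \<Sum>i\<in>UNIV. \<bar>l $ i\<bar>) ` D_l)"
    proof (rule bdd_aboveI2)
      fix k assume "k \<in> D_l"
      then have "norm k \<le> norm ls + 2 * \<delta>"
        using norm_triangle_ineq[of ls "k - ls"] by (simp add: D_l_eq)
      then have "sqrt CARD('d) * norm k \<le> sqrt CARD('d) * (norm ls + 2 * \<delta>)"
        by (intro mult_left_mono) auto
      with l1_norm_le[of k] show "(\<Sum>i\<in>UNIV. \<bar>k $ i\<bar>) \<le> sqrt CARD('d) * (norm ls + 2 * \<delta>)"
        by (rule order_trans)
    qed
  qed (use that in \<open>simp add: D_l_eq\<close>)
  have Xs_feas: "Xs \<in> feasible g A b" using Xs_opt by (simp add: optimal_solution_def)
  then have Xs_sym': "Xs \<in> sym_mats" by (auto simp: feasible_def psd_mats_sym)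
  have \<Gamma>': "norm (grad_g i Y) \<le> \<Gamma>" if "Y \<in> psd_mats" "norm (Y - Xs) \<le> 2 * \<delta>" for Y i
  proof -
    have "norm (grad_g i Y) \<le> (MAX i. norm (grad_g i Y))" by (intro Max_ge) auto
    also have "\<dots> \<le> \<Gamma>"
      unfolding \<Gamma>_eq
    proof (rule cSUP_upper)
      show "bdd_above ((\<lambda>X. MAX i. norm (grad_g i X)) ` D_X)"
      proof (rule bdd_aboveI2)
        fix Y assume Y: "Y \<in> D_X"
        have "norm (grad_g i Y) \<le> (MAX i. norm (grad_g i Xs)) + \<beta>g * (2 * \<delta>)" for i
        proof -
          have "norm (grad_g i Y) \<le> norm (grad_g i Xs) + norm (grad_g i Y - grad_g i Xs)"
            using norm_triangle_ineq[of "grad_g i Xs" "grad_g i Y - grad_g i Xs"] by simp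
          also have "norm (grad_g i Y - grad_g i Xs) \<le> \<beta>g * norm (Y - Xs)"
            using Y by (intro gradient_lipschitz[OF g_smooth _ Xs_sym']) (simp add: D_X_eq psd_mats_sym)
          also have "\<dots> \<le> \<beta>g * (2 * \<delta>)"
            using Y \<beta>g_nonneg by (intro mult_left_mono) (simp_all add: D_X_eq)
          also have "norm (grad_g i Xs) \<le> (MAX i. norm (grad_g i Xs))" by (intro Max_ge) auto
          finally show ?thesis by simp
        qed
        then show "(MAX i. norm (grad_g i Y)) \<le> (MAX i. norm (grad_g i Xs)) + \<beta>g * (2 * \<delta>)"
          by (intro Max.boundedI) auto
      qed
    qed (use that in \<open>simp add: D_X_eq\<close>)
    finally show ?thesis .
  qed
  have \<eta>1: "\<eta> * (2 * sqrt (?bX\<^sup>2 + ?N\<^sup>2 + \<beta>g\<^sup>2)) \<le> 1" and \<eta>2: "\<eta> * (2 * max ?N ?s) \<le> 1"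
    using \<eta>_le lin_op_norm_nonneg[of A] by (auto intro!: le_inverse_ereal)
  have "(\<eta> * ?bX)\<^sup>2 + (\<eta> * ?N)\<^sup>2 \<le> 1 / 4"
    using \<eta>1 \<eta>_pos by (intro scaled_squares_le) auto
  moreover have "\<eta> * ?s \<le> 1 / 2"
  proof -
    have "\<eta> * ?s \<le> \<eta> * max ?N ?s" using \<eta>_pos by (intro mult_left_mono) auto
    then show ?thesis using \<eta>2 by simp
  qed
  ultimately interpret local_extragradient f g A b \<beta> \<beta>g Xs ys ls \<delta> \<Lambda> \<Gamma> \<eta> X Z y w l \<mu>
    using Xs_feas dual \<Lambda>' \<Gamma>' \<delta>0 \<eta>_pos EG D\<delta> by unfold_locales (auto simp: D_def)

  have n_r: "1 \<le> ?n - r" "r < ?n" using indices(1) by auto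
  \<comment> \<open>\<open>rt \<le> r\<close> means that \<open>n - r\<close> is at most the rank of
    \<open>GL\<close>.\<close>
  have GL_pos: "0 < eigval GL (?n - r)"
    using GL_psd n_r r_ge rank_bound[of GL] by (intro eigval_pos_of_rank) (auto simp: GL_eq rt_eq)
  then have \<delta>_pos: "0 < \<delta>" by (simp add: \<delta>_eq less_max_iff_disj)
  \<comment> \<open>The entry attaining the maximum in \<open>\<delta>\<close> decides between
    \<open>k = 1\<close> and \<open>k = rt\<close>; in the second case \<open>rt \<ge> 1\<close>,
    since \<open>sqrt 0\<close> would make \<open>\<delta>\<close> zero.\<close>
  obtain k where k: "1 \<le> k" "?n - r + k - 1 \<le> ?n" "\<delta> = sqrt (real k) * eigval GL (?n - r + k - 1)"
  proof (cases "\<delta> = eigval GL (?n - r)")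
    case True
    then show ?thesis using that[of 1] by simp
  next
    case False
    then have "\<delta> = sqrt rt * eigval GL (?n - r + rt - 1)" by (auto simp: \<delta>_eq max_def split: if_splits)
    moreover from this have "1 \<le> rt" using \<delta>_pos by (cases rt) auto
    ultimately show ?thesis using that[of rt] indices(2) by simp
  qed
  have trunc: "is_trunc_proj r (X t - \<eta> *\<^sub>R fst (saddle_op v)) P \<longleftrightarrow> is_psd_proj (X t - \<eta> *\<^sub>R fst (saddle_op v)) P"
    if t: "t \<ge> 1" and v: "v = (X t, y t, l t) \<or> v = (Z (Suc t), w (Suc t), \<mu> (Suc t))" for t v P
  proof (rule trunc_proj_iff_psd_proj)
    have "fst (saddle_op v) \<in> sym_mats"
      using v psd_mats_sym[OF X_psd[OF t]] psd_mats_sym[OF z_psd(1)[OF t]] by (auto simp: grad_X_L_sym)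
    then show "X t - \<eta> *\<^sub>R fst (saddle_op v) \<in> sym_mats"
      using psd_mats_sym[OF X_psd[OF t]] by (intro subspace_diff subspace_scale subspace_sym_mats)
    show "eigval (X t - \<eta> *\<^sub>R fst (saddle_op v)) (r + 1) \<le> 0"
      using k Dq by (intro step_eigval_nonpos[OF t v m _ n_r(2) k(1,2) \<delta>_pos]) (simp_all add: GL_eq D_def c_def)
  qed (rule n_r(2))

  have ergodic: "f (Xbar T) - f Xs \<le> Rsq / (2 * \<eta> * real T) \<and>
        (ys \<noteq> 0 \<longrightarrow> norm (lin_op A (Xbar T) - b) \<le> Rsq / (2 * norm ys * \<eta> * real T)) \<and>
        (\<Sum>i | g (Xbar T) $ i > 0. g (Xbar T) $ i) \<le> Rsq / (2 * \<eta> * real T)" if T: "T \<ge> 1" for T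
  proof -
    have gap: "L (Xbar T) y' l' - f Xs \<le> Rsq / (2 * \<eta> * real T)"
      if yl: "norm y' \<le> 2 * norm ys" "l' \<in> nonneg_vecs" "norm l' \<le> norm ls + sqrt CARD('d)" for y' l'
    proof -
      have "(norm (y 1 - y'))\<^sup>2 \<le> (SUP y'\<in>C_y. (norm (y 1 - y'))\<^sup>2)"
        using yl by (intro cSUP_upper bdd_above_norm_sq[of _ "2 * norm ys"]) (auto simp: C_y_eq)
      moreover have "(norm (l 1 - l'))\<^sup>2 \<le> (SUP l'\<in>C_l. (norm (l 1 - l'))\<^sup>2)"
        using yl by (intro cSUP_upper bdd_above_norm_sq[of _ "norm ls + sqrt CARD('d)"]) (auto simp: C_l_eq)
      ultimately have "(norm (X 1 - Xs))\<^sup>2 + (norm (y 1 - y'))\<^sup>2 + (norm (l 1 - l'))\<^sup>2 \<le> Rsq"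
        by (simp add: Rsq_eq)
      then show ?thesis
        unfolding Xbar_eq L_eq using \<eta>_pos
        by (intro order_trans[OF ergodic_gap[OF T yl(2)]] divide_right_mono) auto
    qed
    have psd: "Xbar T \<in> psd_mats" unfolding Xbar_eq by (rule average_psd)
    have bounds: "f (Xbar T) - f Xs \<le> Rsq / (2 * \<eta> * real T)"
      "norm ys * norm (lin_op A (Xbar T) - b) \<le> Rsq / (2 * \<eta> * real T)"
      "(\<Sum>i | g (Xbar T) $ i > 0. g (Xbar T) $ i) \<le> Rsq / (2 * \<eta> * real T)"
      by (rule bounds_of_gap[OF psd], rule gap[unfolded L_eq], assumption+)+
    show ?thesis
    proof (intro conjI impI bounds(1,3))
      assume "ys \<noteq> 0"
      then have "norm (lin_op A (Xbar T) - b) \<le> Rsq / (2 * \<eta> * real T) / norm ys"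
        using bounds(2) pos_le_divide_eq[of "norm ys"] by (metis mult.commute zero_less_norm_iff)
      then show "norm (lin_op A (Xbar T) - b) \<le> Rsq / (2 * norm ys * \<eta> * real T)"
        by (simp add: mult_ac)
    qed
  qed

  define M where "M = Max {2 * R0, 3 * sqrt 2 * norm ys, sqrt 2 * (2 * norm ls + sqrt CARD('d))}"
  have M: "2 * R0 \<le> M" "3 * sqrt 2 * norm ys \<le> M" "sqrt 2 * (2 * norm ls + sqrt CARD('d)) \<le> M"
    by (simp_all add: M_def)
  have "0 \<le> sqrt 2 * norm ls" "0 \<le> sqrt 2 * sqrt CARD('d)" by simp_all
  with M(3) have M': "2 * sqrt 2 * norm ls \<le> M" "sqrt 2 * sqrt CARD('d) \<le> M"
    unfolding distrib_left by linarith+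
  have M0: "0 \<le> M" using M(2) by (rule order_trans[rotated]) simp
  have last: "f (Z (T + 1)) - f Xs \<le> R1 / (\<eta> * sqrt (real T)) \<and>
        (ys \<noteq> 0 \<longrightarrow> norm (lin_op A (Z (T + 1)) - b) \<le> R1 / (norm ys * \<eta> * sqrt (real T))) \<and>
        (\<Sum>i | g (Z (T + 1)) $ i > 0. g (Z (T + 1)) $ i) \<le> R1 / (\<eta> * sqrt (real T))" if T: "T \<ge> 1" for T
  proof -
    \<comment> \<open>\<open>3 * sqrt 2\<close> is \<open>2 * sqrt 2\<close> times 3/2, so each of
      the three bounds reduces to a factor that must stay below \<open>3 / 2 * M\<close>.\<close>
    have R1: "R1 / (\<eta> * sqrt (real T)) = \<epsilon> T * (3 / 2 * M)"
      by (simp add: R1_eq \<epsilon>_def M_def[symmetric])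
    \<comment> \<open>The last two entries of the maximum give 1/18 + 1/8, below 1/4; together with
      \<open>2 * D \<le> M\<close> this uses up the factor 3/2.\<close>
    have "sqrt ((norm ys)\<^sup>2 + (norm ls)\<^sup>2) \<le> M / 2"
    proof (rule real_le_lsqrt)
      have "(3 * sqrt 2 * norm ys)\<^sup>2 \<le> M\<^sup>2" "(2 * sqrt 2 * norm ls)\<^sup>2 \<le> M\<^sup>2"
        using M(2) M'(1) by (intro power_mono; simp)+
      then have "18 * (norm ys)\<^sup>2 \<le> M\<^sup>2" "8 * (norm ls)\<^sup>2 \<le> M\<^sup>2"
        by (simp_all add: power_mult_distrib)
      then have "(norm ys)\<^sup>2 + (norm ls)\<^sup>2 \<le> M\<^sup>2 / 4"
        using zero_le_power2[of "norm ys"] by linarith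
      then show "(norm ys)\<^sup>2 + (norm ls)\<^sup>2 \<le> (M / 2)\<^sup>2"
        by (simp add: power_divide)
    qed (use M0 in auto)
    then have "2 * D + sqrt ((norm ys)\<^sup>2 + (norm ls)\<^sup>2) \<le> 3 / 2 * M"
      using DR M(1) by linarith
    from mult_left_mono[OF this \<epsilon>_nonneg[of T]]
    have 1: "f (Z (Suc T)) - f Xs \<le> \<epsilon> T * (3 / 2 * M)"
      using last_iterate_f[OF T] by (simp add: D_def)
    have "1 * norm ys \<le> sqrt 2 * norm ys" "1 * sqrt CARD('d) \<le> sqrt 2 * sqrt CARD('d)"
      by (intro mult_right_mono; simp)+
    then have "norm ys \<le> 3 / 2 * M" "sqrt CARD('d) \<le> 3 / 2 * M"
      using M(2) M'(2) M0 norm_ge_zero[of ys] by linarith+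
    from this[THEN mult_left_mono[OF _ \<epsilon>_nonneg[of T]]]
    have 2: "\<epsilon> T * norm ys \<le> \<epsilon> T * (3 / 2 * M)" and 3: "\<epsilon> T * sqrt CARD('d) \<le> \<epsilon> T * (3 / 2 * M)" .
    have "norm (lin_op A (Z (Suc T)) - b) \<le> \<epsilon> T * (3 / 2 * M) / norm ys" if "ys \<noteq> 0"
      using that order_trans[OF mult_right_mono[OF last_iterate_lin_op[OF T] norm_ge_zero] 2]
        pos_le_divide_eq[of "norm ys"] by (metis zero_less_norm_iff)
    moreover have "R1 / (norm ys * \<eta> * sqrt (real T)) = \<epsilon> T * (3 / 2 * M) / norm ys"
      unfolding R1[symmetric] by (simp add: mult_ac)
    ultimately show ?thesis
      unfolding R1 Suc_eq_plus1[symmetric] using 1 order_trans[OF last_iterate_g[OF T] 3] by metis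
  qed
  show ?thesis
    unfolding L_eq using extragradient_trunc_proj[OF trunc] ergodic last by blast
qed

end
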